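(* Fix an integer $n\geq 3$. Let $\Omega\subseteq\mathbb{C}$ be an annulus with $I:=\Omega\cap[0,\infty)$ an interval, and let $f:\Omega\to\mathbb{C}$. If $\Omega$ is of pd-type, then the following are equivalent: (1) A Hermitian matrix $A\in M_n(\Omega)$ is positive definite if and only if $f[A]$ is positive definite. (2) There exists a real $\alpha>0$ such that either $f(z)=\alpha z$ for all $z\in\Omega$, or $f(z)=\alpha\overline{z}$ for all $z\in\Omega$. The result holds verbatim with "pd-type" replaced by "psd-type" and "definite" replaced by "semidefinite".
   Context: $M_n(\Omega)$ denotes the set of $n\times n$ matrices with entries in $\Omega$, and $f[A]:=(f(a_{ij}))$ for $A=(a_{ij})$. Positive (semi)definite matrices are Hermitian by definition. An annulus is a set of the form $\{z\in\mathbb{C}:|z|\in I\}$ for an interval $I\subseteq[0,\infty)$ (so $I=\Omega\cap[0,\infty)$). $\Omega$ is of pd-type if for all $z\in\Omega\setminus I$ there exists $\epsilon>0$ such that $|z|+\epsilon\in I$; and of psd-type if for all $z\in\Omega\setminus I$ there exists $\delta>0$ such that $|z|-\delta\in I$.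
   Formalization: The annulus Ω is assumed different from {0}: for I = {0} the claim fails, since f(0) = 1 satisfies (1) in both the definite and the semidefinite version but not (2). *)

theory Defs
  imports
    "HOL-Analysis.Topology_Euclidean_Space"
    "Jordan_Normal_Form.Schur_Decomposition"
begin

definition annulus :: "real set \<Rightarrow> complex set" where
  "annulus I = {z. cmod z \<in> I}"

(* The radii of a set of complex numbers: its intersection with the half-line [0, oo),
   read as a set of reals. *)
definition radii :: "complex set \<Rightarrow> real set" where
  "radii \<Omega> = {r. 0 \<le> r \<and> complex_of_real r \<in> \<Omega>}"

definition is_annulus :: "complex set \<Rightarrow> bool" where
  "is_annulus \<Omega> \<longleftrightarrow> (\<exists>I. is_interval I \<and> I \<subseteq> {0..} \<and> \<Omega> = annulus I)"

definition pd_type :: "complex set \<Rightarrow> bool" where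
  "pd_type \<Omega> \<longleftrightarrow>
     (\<forall>z \<in> \<Omega> - complex_of_real ` radii \<Omega>. \<exists>\<epsilon>>0. cmod z + \<epsilon> \<in> radii \<Omega>)"

definition psd_type :: "complex set \<Rightarrow> bool" where
  "psd_type \<Omega> \<longleftrightarrow>
     (\<forall>z \<in> \<Omega> - complex_of_real ` radii \<Omega>. \<exists>\<delta>>0. cmod z - \<delta> \<in> radii \<Omega>)"

definition mats_over :: "nat \<Rightarrow> 'a set \<Rightarrow> 'a mat set" where
  "mats_over n \<Omega> = {A \<in> carrier_mat n n. elements_mat A \<subseteq> \<Omega>}"

definition hermitian :: "complex mat \<Rightarrow> bool" where
  "hermitian A \<longleftrightarrow> mat_adjoint A = A"

(* The order on complex numbers is the one of HOL-Library.Complex_Order: "0 < w" says that w is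
   real and positive. The term (A *\<^sub>v x) \<bullet>c x is the quadratic form x^* A x. *)
definition pos_def :: "complex mat \<Rightarrow> bool" where
  "pos_def A \<longleftrightarrow> hermitian A \<and>
     (\<forall>x \<in> carrier_vec (dim_row A). x \<noteq> 0\<^sub>v (dim_row A) \<longrightarrow> 0 < (A *\<^sub>v x) \<bullet>c x)"

definition pos_semidef :: "complex mat \<Rightarrow> bool" where
  "pos_semidef A \<longleftrightarrow> hermitian A \<and>
     (\<forall>x \<in> carrier_vec (dim_row A). 0 \<le> (A *\<^sub>v x) \<bullet>c x)"

end

theory Submission
  imports
    Defs
    "HOL-Analysis.Henstock_Kurzweil_Integration"
    "HOL-Analysis.Homotopy"
begin

text \<open>
  Repeating the last row and column of a small Hermitian matrix (and raising the repeated diagonal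
  entries slightly in the definite case) reduces everything to matrices of size 2 and 3.
  The 2 by 2 matrices show that \<open>f\<close> is positive, strictly increasing and continuous
  from the right on the radii, and that \<open>|f(w)| = f(|w|)\<close>. Near-singular 3 by 3
  matrices force the phases to satisfy \<open>f(r u) = f(r) \<phi>(u)\<close> with one character
  \<open>\<phi>\<close> of the unit circle for all radii. For diagonal \<open>s\<close> and
  off-diagonal entries \<open>r u, r, r\<close> the determinant is
  \<open>s\<^sup>3 + 2 r\<^sup>3 Re u - 3 s r\<^sup>2\<close>, and \<open>f\<close> preserves its
  sign. As \<open>s\<close> decreases to \<open>r\<close> this makes \<open>\<phi>\<close>
  continuous and injective, hence the identity or conjugation; comparing the values of
  \<open>Re u\<close> where the determinant vanishes then gives \<open>f(s) / f(r) = s / r\<close>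
  for \<open>r < s < 2 r\<close>, so \<open>f\<close> is linear on the radii.
\<close>

subsection \<open>Hermitian forms and small matrices\<close>

text \<open>No regularity of f is given, so everything must be read off from signs of determinants.
  The type conditions enter once: for a positive radius r the point -r lies in \<Omega> but not in
  I, so pd-type leaves I without a maximum and psd-type leaves it without a positive minimum. The
  first gives room to raise a diagonal entry, the second gives radii to the left of every positive
  radius.

  The phase law rests on one family of matrices: with diagonal s and off-diagonal entries r u, s u
  w, r w the determinant is 0 for all unit u and w. Nonnegativity of the image determinant then says
  that a complex number has real part at least its modulus, which determines it.

  The cubic in the overview equals (s - r)^2 (s + 2 r) at u = 1. It is positive for s > r but tends
  to 0 as s approaches r, so its sign detects how close Re u is to 1. This is what replaces
  continuity of the phase.\<close>

definition hform :: "nat \<Rightarrow> (nat \<Rightarrow> nat \<Rightarrow> complex) \<Rightarrow> (nat \<Rightarrow> complex) \<Rightarrow> complex" where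
  "hform n B x = (\<Sum>i<n. \<Sum>j<n. B i j * x j * cnj (x i))"

definition herm :: "nat \<Rightarrow> (nat \<Rightarrow> nat \<Rightarrow> complex) \<Rightarrow> bool" where
  "herm n B \<longleftrightarrow> (\<forall>i<n. \<forall>j<n. B j i = cnj (B i j))"

definition pd :: "nat \<Rightarrow> (nat \<Rightarrow> nat \<Rightarrow> complex) \<Rightarrow> bool" where
  "pd n B \<longleftrightarrow> herm n B \<and> (\<forall>x. (\<exists>i<n. x i \<noteq> 0) \<longrightarrow> 0 < hform n B x)"

definition psd :: "nat \<Rightarrow> (nat \<Rightarrow> nat \<Rightarrow> complex) \<Rightarrow> bool" where
  "psd n B \<longleftrightarrow> herm n B \<and> (\<forall>x. 0 \<le> hform n B x)"

lemma hermitian_iff_herm: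
  assumes "A \<in> carrier_mat n n"
  shows "hermitian A \<longleftrightarrow> herm n (\<lambda>i j. A $$ (i, j))"
proof -
  have adj: "mat_adjoint A \<in> carrier_mat n n" "\<And>i j. i < n \<Longrightarrow> j < n \<Longrightarrow> mat_adjoint A $$ (i, j) = cnj (A $$ (j, i))"
    using assms by (auto simp: mat_adjoint_def mat_of_rows_def)
  have "hermitian A \<longleftrightarrow> (\<forall>i<n. \<forall>j<n. mat_adjoint A $$ (i, j) = A $$ (i, j))"
    unfolding hermitian_def using adj(1) assms by (auto intro!: eq_matI)
  then show ?thesis
    using adj(2) unfolding herm_def by (metis complex_cnj_cnj)
qed

lemma quadratic_form_eq_hform:
  assumes "A \<in> carrier_mat n n" "v \<in> carrier_vec n"
  shows "(A *\<^sub>v v) \<bullet>c v = hform n (\<lambda>i j. A $$ (i, j)) (\<lambda>i. vec_index v i)"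
  using assms
  by (auto simp: hform_def scalar_prod_def atLeast0LessThan sum_distrib_right intro!: sum.cong)

lemma hform_cong:
  assumes "\<And>i. i < n \<Longrightarrow> x i = y i" "\<And>i j. i < n \<Longrightarrow> j < n \<Longrightarrow> A i j = B i j"
  shows "hform n A x = hform n B y"
  unfolding hform_def using assms by (intro sum.cong) auto

lemma herm_cong:
  assumes "\<And>i j. i < n \<Longrightarrow> j < n \<Longrightarrow> A i j = B i j"
  shows "herm n A \<longleftrightarrow> herm n B"
  unfolding herm_def using assms by auto

lemma pd_cong:
  assumes "\<And>i j. i < n \<Longrightarrow> j < n \<Longrightarrow> A i j = B i j"
  shows "pd n A \<longleftrightarrow> pd n B"
  unfolding pd_def using assms herm_cong[of n A B] hform_cong[of n _ _ A B] by metis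

lemma psd_cong:
  assumes "\<And>i j. i < n \<Longrightarrow> j < n \<Longrightarrow> A i j = B i j"
  shows "psd n A \<longleftrightarrow> psd n B"
  unfolding psd_def using assms herm_cong[of n A B] hform_cong[of n _ _ A B] by metis

lemma pos_def_iff_pd:
  assumes A: "A \<in> carrier_mat n n"
  shows "pos_def A \<longleftrightarrow> pd n (\<lambda>i j. A $$ (i, j))" (is "_ \<longleftrightarrow> pd n ?A")
proof -
  have "(\<forall>v \<in> carrier_vec n. v \<noteq> 0\<^sub>v n \<longrightarrow> 0 < hform n ?A (\<lambda>i. vec_index v i)) \<longleftrightarrow>
        (\<forall>x. (\<exists>i<n. x i \<noteq> 0) \<longrightarrow> 0 < hform n ?A x)" (is "?L \<longleftrightarrow> ?R")
  proof
    assume L: ?L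
    show ?R
    proof (intro allI impI)
      fix x :: "nat \<Rightarrow> complex" assume "\<exists>i<n. x i \<noteq> 0"
      then have "Matrix.vec n x \<noteq> 0\<^sub>v n" by (metis index_vec index_zero_vec(1))
      then have "0 < hform n ?A (\<lambda>i. vec_index (Matrix.vec n x) i)" using L by auto
      also have "\<dots> = hform n ?A x" by (rule hform_cong) auto
      finally show "0 < hform n ?A x" .
    qed
  next
    assume R: ?R
    show ?L
    proof (intro ballI impI)
      fix v :: "complex Matrix.vec" assume "v \<in> carrier_vec n" "v \<noteq> 0\<^sub>v n"
      then have "\<exists>i<n. vec_index v i \<noteq> 0" by (metis carrier_vecD eq_vecI index_zero_vec)
      then show "0 < hform n ?A (\<lambda>i. vec_index v i)" using R by blast
    qed
  qed
  then show ?thesis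
    unfolding pos_def_def pd_def using A hermitian_iff_herm[OF A] quadratic_form_eq_hform[OF A] by auto
qed

lemma pos_semidef_iff_psd:
  assumes A: "A \<in> carrier_mat n n"
  shows "pos_semidef A \<longleftrightarrow> psd n (\<lambda>i j. A $$ (i, j))" (is "_ \<longleftrightarrow> psd n ?A")
proof -
  have "hform n ?A x = hform n ?A (\<lambda>i. vec_index (Matrix.vec n x) i)" for x
    by (rule hform_cong) auto
  then have "(\<forall>v \<in> carrier_vec n. 0 \<le> hform n ?A (\<lambda>i. vec_index v i)) \<longleftrightarrow> (\<forall>x. 0 \<le> hform n ?A x)"
    by (metis vec_carrier)
  then show ?thesis
    unfolding pos_semidef_def psd_def
    using A hermitian_iff_herm[OF A] quadratic_form_eq_hform[OF A] by auto
qed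

section \<open>Padding a small matrix to size n\<close>

definition pad :: "nat \<Rightarrow> (nat \<Rightarrow> nat \<Rightarrow> complex) \<Rightarrow> complex \<Rightarrow> nat \<Rightarrow> nat \<Rightarrow> complex" where
  "pad k B D i j = (if i = j \<and> k \<le> i then D else B (min i (k - 1)) (min j (k - 1)))"

text \<open>Repeating an index, rather than bordering by zeros, keeps all entries among those of
  \<open>B\<close> and \<open>D\<close>, so the padded matrix stays over the annulus even when 0 is
  not in it. Summing the coordinates that share an index folds \<open>x\<close> into a vector of
  length \<open>k\<close>; the only other contribution is the diagonal excess
  \<open>D - B (k - 1) (k - 1)\<close> at the positions from \<open>k\<close> on.\<close>

lemma hform_pad:
  assumes "1 \<le> k" "k \<le> n"
  shows "hform n (pad k B D) x =
    hform k B (\<lambda>l. \<Sum>i\<in>{i\<in>{..<n}. min i (k - 1) = l}. x i)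
    + (D - B (k - 1) (k - 1)) * of_real (\<Sum>i\<in>{k..<n}. (cmod (x i))\<^sup>2)"
proof -
  define c where "c i = min i (k - 1)" for i
  have c: "c ` {..<n} \<subseteq> {..<k}" using assms by (auto simp: c_def)
  have "pad k B D i j = B (c i) (c j) + (if i = j \<and> k \<le> i then D - B (k - 1) (k - 1) else 0)" for i j
    unfolding pad_def c_def using assms by (auto simp: min_def)
  then have "hform n (pad k B D) x = (\<Sum>i<n. \<Sum>j<n. B (c i) (c j) * x j * cnj (x i)) +
     (\<Sum>i<n. \<Sum>j<n. (if i = j \<and> k \<le> i then D - B (k - 1) (k - 1) else 0) * x j * cnj (x i))"
    by (simp add: hform_def sum.distrib algebra_simps)
  also have "(\<Sum>i<n. \<Sum>j<n. (if i = j \<and> k \<le> i then D - B (k - 1) (k - 1) else 0) * x j * cnj (x i))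
     = (\<Sum>i<n. \<Sum>j<n. if i = j then (if k \<le> i then (D - B (k - 1) (k - 1)) * x j * cnj (x i) else 0) else 0)"
    by (intro sum.cong) auto
  also have "\<dots> = (\<Sum>i<n. if k \<le> i then (D - B (k - 1) (k - 1)) * x i * cnj (x i) else 0)"
    by (intro sum.cong) auto
  also have "\<dots> = (\<Sum>i\<in>{k..<n}. (D - B (k - 1) (k - 1)) * x i * cnj (x i))"
    by (rule sum.mono_neutral_cong_right) auto
  also have "\<dots> = (D - B (k - 1) (k - 1)) * of_real (\<Sum>i\<in>{k..<n}. (cmod (x i))\<^sup>2)"
    by (simp add: sum_distrib_left complex_norm_square mult.assoc del: of_real_power)
  also have "(\<Sum>i<n. \<Sum>j<n. B (c i) (c j) * x j * cnj (x i)) =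
     hform k B (\<lambda>l. \<Sum>i\<in>{i\<in>{..<n}. c i = l}. x i)"
  proof -
    have "(\<Sum>i<n. \<Sum>j<n. B (c i) (c j) * x j * cnj (x i))
      = (\<Sum>l<k. \<Sum>i\<in>{i\<in>{..<n}. c i = l}. \<Sum>j<n. B (c i) (c j) * x j * cnj (x i))"
      by (rule sum.group[symmetric]) (use c in auto)
    also have "\<dots> = (\<Sum>l<k. \<Sum>i\<in>{i\<in>{..<n}. c i = l}. \<Sum>m<k. \<Sum>j\<in>{j\<in>{..<n}. c j = m}. B l m * x j * cnj (x i))"
    proof (rule sum.cong[OF refl], rule sum.cong[OF refl])
      fix l i assume "i \<in> {i \<in> {..<n}. c i = l}"
      then have "(\<Sum>m<k. \<Sum>j\<in>{j\<in>{..<n}. c j = m}. B l m * x j * cnj (x i)) =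
         (\<Sum>m<k. \<Sum>j\<in>{j\<in>{..<n}. c j = m}. B (c i) (c j) * x j * cnj (x i))"
        by (intro sum.cong) auto
      also have "\<dots> = (\<Sum>j<n. B (c i) (c j) * x j * cnj (x i))"
        by (rule sum.group) (use c in auto)
      finally show "(\<Sum>j<n. B (c i) (c j) * x j * cnj (x i)) = (\<Sum>m<k. \<Sum>j\<in>{j\<in>{..<n}. c j = m}. B l m * x j * cnj (x i))" ..
    qed
    also have "\<dots> = (\<Sum>l<k. \<Sum>m<k. \<Sum>i\<in>{i\<in>{..<n}. c i = l}. \<Sum>j\<in>{j\<in>{..<n}. c j = m}. B l m * x j * cnj (x i))"
      by (rule sum.cong[OF refl], rule sum.swap)
    also have "\<dots> = hform k B (\<lambda>l. \<Sum>i\<in>{i\<in>{..<n}. c i = l}. x i)"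
    proof -
      have "(\<Sum>i\<in>S. \<Sum>j\<in>T. b * x j * cnj (x i)) = b * sum x T * cnj (sum x S)" for b S T
      proof -
        have "(\<Sum>i\<in>S. \<Sum>j\<in>T. b * x j * cnj (x i)) = (\<Sum>i\<in>S. b * sum x T * cnj (x i))"
          by (simp add: sum_distrib_left sum_distrib_right)
        then show ?thesis by (simp add: sum_distrib_left)
      qed
      then show ?thesis unfolding hform_def by (simp only:)
    qed
    finally show ?thesis .
  qed
  finally show ?thesis by (simp add: c_def)
qed

text \<open>Extending a test vector by zeros is how positivity descends from the padded matrix to
  \<open>B\<close>.\<close>

lemma hform_pad_supported:
  assumes "1 \<le> k" "k \<le> n" "\<And>i. k \<le> i \<Longrightarrow> x i = 0"
  shows "hform n (pad k B D) x = hform k B x"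
proof -
  have "(\<Sum>i\<in>{i\<in>{..<n}. min i (k - 1) = l}. x i) = x l" if "l < k" for l
  proof -
    have "(\<Sum>i\<in>{i\<in>{..<n}. min i (k - 1) = l}. x i) = (\<Sum>i\<in>{l}. x i)"
    proof (rule sum.mono_neutral_right)
      show "\<forall>i\<in>{i\<in>{..<n}. min i (k - 1) = l} - {l}. x i = 0"
      proof
        fix i assume "i \<in> {i\<in>{..<n}. min i (k - 1) = l} - {l}"
        then have "k \<le> i" by (auto simp: min_def split: if_splits)
        then show "x i = 0" by (rule assms(3))
      qed
    qed (use assms(1,2) that in auto)
    then show ?thesis by simp
  qed
  then have "hform k B (\<lambda>l. \<Sum>i\<in>{i\<in>{..<n}. min i (k - 1) = l}. x i) = hform k B x"
    by (intro hform_cong) auto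
  then show ?thesis using hform_pad[OF assms(1,2)] assms(3) by simp
qed

lemma hermI:
  assumes "\<And>i j. i < n \<Longrightarrow> j < n \<Longrightarrow> B j i = cnj (B i j)"
  shows "herm n B"
  using assms unfolding herm_def by blast

lemma hermD:
  assumes "herm n B" "i < n" "j < n"
  shows "B j i = cnj (B i j)"
  using assms unfolding herm_def by blast

lemma herm_of_herm_pad:
  assumes "1 \<le> k" "k \<le> n" "herm n (pad k B D)"
  shows "herm k B"
proof (rule hermI)
  fix i j assume "i < k" "j < k"
  then show "B j i = cnj (B i j)" using hermD[OF assms(3), of i j] assms(2) by (simp add: pad_def)
qed

lemma herm_pad:
  assumes "1 \<le> k" "k \<le> n" "herm k B" "D \<in> \<real>"
  shows "herm n (pad k B D)"
proof (rule hermI)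
  fix i j :: nat
  have "B (min j (k - 1)) (min i (k - 1)) = cnj (B (min i (k - 1)) (min j (k - 1)))"
    using assms(1) by (intro hermD[OF assms(3)]) auto
  moreover have "cnj D = D" using assms(4) Reals_cnj_iff by blast
  ultimately show "pad k B D j i = cnj (pad k B D i j)" by (simp add: pad_def)
qed

lemma pd_of_pd_pad:
  assumes "1 \<le> k" "k \<le> n" "pd n (pad k B D)"
  shows "pd k B"
  unfolding pd_def
proof (intro conjI allI impI)
  show "herm k B" using assms herm_of_herm_pad pd_def by blast
  fix x :: "nat \<Rightarrow> complex" assume x: "\<exists>i<k. x i \<noteq> 0"
  define y where "y i = (if i < k then x i else 0)" for i
  have "\<exists>i<n. y i \<noteq> 0" using x assms unfolding y_def by (metis less_le_trans)
  then have "0 < hform n (pad k B D) y" using assms(3) pd_def by blast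
  also have "\<dots> = hform k B y" by (rule hform_pad_supported) (use assms in \<open>auto simp: y_def\<close>)
  also have "\<dots> = hform k B x" by (rule hform_cong) (auto simp: y_def)
  finally show "0 < hform k B x" .
qed

text \<open>If some coordinate from \<open>k\<close> on is nonzero, the diagonal excess already
  contributes a positive amount; otherwise the vector lives on the first \<open>k\<close>
  coordinates and \<open>B\<close> decides.\<close>

lemma pd_pad:
  assumes k: "1 \<le> k" "k \<le> n" and B: "pd k B" and D: "D \<in> \<real>" "B (k - 1) (k - 1) < D"
  shows "pd n (pad k B D)"
  unfolding pd_def
proof (intro conjI allI impI)
  show "herm n (pad k B D)" using assms herm_pad pd_def by blast
  fix x :: "nat \<Rightarrow> complex" assume x: "\<exists>i<n. x i \<noteq> 0"
  show "0 < hform n (pad k B D) x"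
  proof (cases "\<exists>i\<in>{k..<n}. x i \<noteq> 0")
    case True
    then obtain m where "m \<in> {k..<n}" "x m \<noteq> 0" by blast
    then have "0 < (\<Sum>i\<in>{k..<n}. (cmod (x i))\<^sup>2)"
      by (intro sum_pos2[of _ m]) auto
    then have "0 < (D - B (k - 1) (k - 1)) * of_real (\<Sum>i\<in>{k..<n}. (cmod (x i))\<^sup>2)"
      using D by (auto simp: less_complex_def simp flip: of_real_power of_real_sum)
    moreover have "0 \<le> hform k B y" for y
    proof (cases "\<exists>i<k. y i \<noteq> 0")
      case True then show ?thesis using B unfolding pd_def by (auto intro: less_imp_le)
    next
      case False then have "hform k B y = 0" unfolding hform_def by (intro sum.neutral) auto
      then show ?thesis by simp
    qed
    ultimately show ?thesis unfolding hform_pad[OF k] by (intro add_nonneg_pos)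
  next
    case False
    then have x0: "x i = 0" if "k \<le> i" "i < n" for i using that by (meson atLeastLessThan_iff)
    define y where "y i = (if i < k then x i else 0)" for i
    have "hform n (pad k B D) x = hform n (pad k B D) y"
      by (rule hform_cong) (auto simp: y_def x0 not_less)
    also have "\<dots> = hform k B y"
      by (rule hform_pad_supported) (use k in \<open>auto simp: y_def\<close>)
    finally have "hform n (pad k B D) x = hform k B y" .
    moreover have "\<exists>i<k. y i \<noteq> 0" using x x0 unfolding y_def by (metis linorder_not_less)
    ultimately show ?thesis using B unfolding pd_def by metis
  qed
qed

text \<open>The diagonal excess vanishes, so the padded form is the form of \<open>B\<close> at the
  folded coordinates. In contrast to \<open>pd_pad\<close>, no larger diagonal entry has to be
  available.\<close>

lemma psd_pad_iff:
  assumes k: "1 \<le> k" "k \<le> n"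
  shows "psd n (pad k B (B (k - 1) (k - 1))) \<longleftrightarrow> psd k B"
proof
  assume P: "psd n (pad k B (B (k - 1) (k - 1)))"
  show "psd k B"
    unfolding psd_def
  proof (intro conjI allI)
    show "herm k B" using P k herm_of_herm_pad psd_def by blast
    fix x :: "nat \<Rightarrow> complex"
    define y where "y i = (if i < k then x i else 0)" for i
    have "0 \<le> hform n (pad k B (B (k - 1) (k - 1))) y" using P psd_def by blast
    also have "\<dots> = hform k B y" by (rule hform_pad_supported) (use k in \<open>auto simp: y_def\<close>)
    also have "\<dots> = hform k B x" by (rule hform_cong) (auto simp: y_def)
    finally show "0 \<le> hform k B x" .
  qed
next
  assume P: "psd k B"
  have "B (k - 1) (k - 1) = cnj (B (k - 1) (k - 1))" using P k by (intro hermD) (auto simp: psd_def)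
  then have "B (k - 1) (k - 1) \<in> \<real>" by (metis Reals_cnj_iff)
  then show "psd n (pad k B (B (k - 1) (k - 1)))"
    using P k herm_pad[OF k] unfolding psd_def by (simp add: hform_pad)
qed

section \<open>Determinant criteria in sizes 2 and 3\<close>

definition mat2 :: "complex \<Rightarrow> complex \<Rightarrow> complex \<Rightarrow> nat \<Rightarrow> nat \<Rightarrow> complex" where
  "mat2 a b w i j = (if i = j then (if i = 0 then a else b) else if i < j then w else cnj w)"

definition mat3 :: "complex \<Rightarrow> complex \<Rightarrow> complex \<Rightarrow> complex \<Rightarrow> nat \<Rightarrow> nat \<Rightarrow> complex" where
  "mat3 a u v w i j =
     (let t = if min i j = 0 then (if max i j = 1 then u else v) else w
      in if i = j then a else if i < j then t else cnj t)"

text \<open>The determinant of the Hermitian matrix \<open>mat3 (of_real a) u v w\<close>, as a real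
  number.\<close>

definition det3 :: "real \<Rightarrow> complex \<Rightarrow> complex \<Rightarrow> complex \<Rightarrow> real" where
  "det3 a u v w = a ^ 3 + 2 * Re (u * w * cnj v) - a * ((cmod u)\<^sup>2 + (cmod v)\<^sup>2 + (cmod w)\<^sup>2)"

lemma herm_mat2: "herm 2 (mat2 (of_real a) (of_real b) w)"
  by (auto simp: herm_def mat2_def less_2_cases_iff)

lemma herm_mat3: "herm 3 (mat3 (of_real a) u v w)"
  by (auto simp: herm_def mat3_def Let_def)

lemma mat2_hform_identity:
  fixes a b :: real
  shows "of_real a * hform 2 (mat2 (of_real a) (of_real b) w) x =
    of_real ((cmod (of_real a * x 0 + w * x 1))\<^sup>2 + (a * b - (cmod w)\<^sup>2) * (cmod (x 1))\<^sup>2)"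
proof -
  have "hform 2 (mat2 (of_real a) (of_real b) w) x =
    of_real a * x 0 * cnj (x 0) + w * x 1 * cnj (x 0) + cnj w * x 0 * cnj (x 1) + of_real b * x 1 * cnj (x 1)"
    by (simp add: hform_def mat2_def numeral_2_eq_2)
  then show ?thesis
    by (simp add: complex_norm_square algebra_simps del: of_real_power)
qed

text \<open>Completing squares twice, cleared of the denominators \<open>a\<close> and \<open>d\<close>.\<close>

lemma mat3_hform_identity:
  fixes a :: real and u v w :: complex
  defines "d \<equiv> a\<^sup>2 - (cmod u)\<^sup>2"
  defines "e \<equiv> of_real a * w - cnj u * v"
  shows "of_real (a * d) * hform 3 (mat3 (of_real a) u v w) x =
    of_real (d * (cmod (of_real a * x 0 + u * x 1 + v * x 2))\<^sup>2 +
      (cmod (of_real d * x 1 + e * x 2))\<^sup>2 + a * det3 a u v w * (cmod (x 2))\<^sup>2)"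
proof -
  have re: "2 * complex_of_real (Re z) = z + cnj z" for z
    by (simp add: complex_eq_iff)
  have h: "hform 3 (mat3 (of_real a) u v w) x =
    of_real a * x 0 * cnj (x 0) + of_real a * x 1 * cnj (x 1) + of_real a * x 2 * cnj (x 2)
    + u * x 1 * cnj (x 0) + v * x 2 * cnj (x 0) + w * x 2 * cnj (x 1)
    + cnj u * x 0 * cnj (x 1) + cnj v * x 0 * cnj (x 2) + cnj w * x 1 * cnj (x 2)"
    by (simp add: hform_def mat3_def numeral_3_eq_3 numeral_2_eq_2 algebra_simps)
  have det: "complex_of_real (det3 a u v w) = of_real a ^ 3 + (u * w * cnj v + cnj u * cnj w * v)
     - of_real a * (u * cnj u + v * cnj v + w * cnj w)"
    using re[of "u * w * cnj v"]
    by (simp add: det3_def complex_norm_square del: of_real_power)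
       (simp add: of_real_power)
  have d: "complex_of_real d = of_real a ^ 2 - u * cnj u"
    by (simp add: d_def complex_norm_square flip: of_real_power)
  \<comment> \<open>The conjugates are replaced by independent variables, which turns the claim into
    a polynomial identity over the complex numbers. \<open>D\<close> is the leading 2 by 2
    minor.\<close>
  have "D = A * A - U * U' \<Longrightarrow> A * D * (A * p * p' + A * q * q' + A * r * r' + U * q * p' + V * r * p' + W * r * q'
      + U' * p * q' + V' * p * r' + W' * q * r') =
     D * ((A * p + U * q + V * r) * (A * p' + U' * q' + V' * r'))
     + (D * q + (A * W - U' * V) * r) * (D * q' + (A * W' - U * V') * r')
     + A * (A ^ 3 + (U * W * V' + U' * W' * V) - A * (U * U' + V * V' + W * W')) * (r * r')"
    for A D U U' V V' W W' p q r p' q' r' :: complex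
    by (simp only:) (simp add: algebra_simps power3_eq_cube)
  from this[where A = "of_real a" and D = "of_real a * of_real a - u * cnj u" and U = u and U' = "cnj u" and V = v and V' = "cnj v"
      and W = w and W' = "cnj w" and p = "x 0" and q = "x 1" and r = "x 2" and p' = "cnj (x 0)" and q' = "cnj (x 1)" and r' = "cnj (x 2)", OF refl]
  show ?thesis
    unfolding of_real_add of_real_mult complex_norm_square h det e_def
    by (simp add: d power2_eq_square mult.commute[of "cnj u" u])
qed

lemma pdD: "pd n B \<Longrightarrow> i < n \<Longrightarrow> x i \<noteq> 0 \<Longrightarrow> 0 < hform n B x"
  unfolding pd_def by blast

lemma pd_mat2_iff:
  assumes "0 < a"
  shows "pd 2 (mat2 (of_real a) (of_real b) w) \<longleftrightarrow> (cmod w)\<^sup>2 < a * b"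
proof
  assume P: "pd 2 (mat2 (of_real a) (of_real b) w)"
  \<comment> \<open>This vector annihilates the square in \<open>mat2_hform_identity\<close>,
    leaving only the determinant.\<close>
  define x where "x i = (if i = 0 then - w / of_real a else 1 :: complex)" for i :: nat
  have "0 < hform 2 (mat2 (of_real a) (of_real b) w) x"
    by (rule pdD[OF P, of 1]) (auto simp: x_def)
  then have "0 < of_real a * hform 2 (mat2 (of_real a) (of_real b) w) x"
    using assms by (simp add: less_complex_def)
  then have "0 < complex_of_real (a * b - (cmod w)\<^sup>2)"
    unfolding mat2_hform_identity using assms by (simp add: x_def)
  then show "(cmod w)\<^sup>2 < a * b" by (simp add: less_complex_def)
next
  assume d: "(cmod w)\<^sup>2 < a * b"
  show "pd 2 (mat2 (of_real a) (of_real b) w)"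
    unfolding pd_def
  proof (intro conjI herm_mat2 allI impI)
    fix x :: "nat \<Rightarrow> complex" assume x: "\<exists>i<2. x i \<noteq> 0"
    have "0 < (cmod (of_real a * x 0 + w * x 1))\<^sup>2 + (a * b - (cmod w)\<^sup>2) * (cmod (x 1))\<^sup>2"
    proof (cases "x 1 = 0")
      case True
      then have "x 0 \<noteq> 0" using x by (auto simp: less_2_cases_iff)
      then show ?thesis using True assms by simp
    next
      case False
      then show ?thesis using d by (intro add_nonneg_pos mult_pos_pos) auto
    qed
    then have "0 < of_real a * hform 2 (mat2 (of_real a) (of_real b) w) x"
      unfolding mat2_hform_identity by (simp add: less_complex_def del: of_real_add)
    then show "0 < hform 2 (mat2 (of_real a) (of_real b) w) x"
      using assms by (simp add: less_complex_def zero_less_mult_iff)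
  qed
qed

lemma pos_of_pd_mat2:
  assumes "pd 2 (mat2 a b w)"
  shows "0 < a"
proof -
  define x where "x i = (if i = 0 then 1 else 0 :: complex)" for i :: nat
  have "0 < hform 2 (mat2 a b w) x"
    by (rule pdD[OF assms, of 0]) (auto simp: x_def)
  also have "hform 2 (mat2 a b w) x = a"
    by (simp add: hform_def mat2_def x_def numeral_2_eq_2)
  finally show ?thesis .
qed

lemma psd_mat2_iff:
  assumes "0 < a"
  shows "psd 2 (mat2 (of_real a) (of_real b) w) \<longleftrightarrow> (cmod w)\<^sup>2 \<le> a * b"
proof
  assume P: "psd 2 (mat2 (of_real a) (of_real b) w)"
  define x where "x i = (if i = 0 then - w / of_real a else 1 :: complex)" for i :: nat
  have "0 \<le> hform 2 (mat2 (of_real a) (of_real b) w) x"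
    using P unfolding psd_def by blast
  then have "0 \<le> of_real a * hform 2 (mat2 (of_real a) (of_real b) w) x"
    using assms by (simp add: less_eq_complex_def)
  then have "0 \<le> complex_of_real (a * b - (cmod w)\<^sup>2)"
    unfolding mat2_hform_identity using assms by (simp add: x_def)
  then show "(cmod w)\<^sup>2 \<le> a * b" by (simp add: less_eq_complex_def)
next
  assume d: "(cmod w)\<^sup>2 \<le> a * b"
  show "psd 2 (mat2 (of_real a) (of_real b) w)"
    unfolding psd_def
  proof (intro conjI herm_mat2 allI)
    fix x :: "nat \<Rightarrow> complex"
    have "0 \<le> (cmod (of_real a * x 0 + w * x 1))\<^sup>2 + (a * b - (cmod w)\<^sup>2) * (cmod (x 1))\<^sup>2"
      using d by simp
    then have "0 \<le> of_real a * hform 2 (mat2 (of_real a) (of_real b) w) x"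
      unfolding mat2_hform_identity by (simp add: less_eq_complex_def del: of_real_add)
    then show "0 \<le> hform 2 (mat2 (of_real a) (of_real b) w) x"
      using assms by (simp add: less_eq_complex_def zero_le_mult_iff)
  qed
qed

lemma nonneg_of_psd_mat2:
  assumes "psd 2 (mat2 a b w)"
  shows "0 \<le> a"
proof -
  define x where "x i = (if i = 0 then 1 else 0 :: complex)" for i :: nat
  have "0 \<le> hform 2 (mat2 a b w) x"
    using assms unfolding psd_def by blast
  also have "hform 2 (mat2 a b w) x = a"
    by (simp add: hform_def mat2_def x_def numeral_2_eq_2)
  finally show ?thesis .
qed

text \<open>Covers a vanishing corner entry, where the criterion \<open>psd_mat2_iff\<close> does
  not apply.\<close>

lemma psd_mat2_zero:
  assumes "0 \<le> b"
  shows "psd 2 (mat2 0 (of_real b) 0)"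
proof -
  have "hform 2 (mat2 0 (of_real b) 0) x = of_real (b * (cmod (x 1))\<^sup>2)" for x
    unfolding of_real_mult complex_norm_square by (simp add: hform_def mat2_def numeral_2_eq_2)
  then show ?thesis
    using assms herm_mat2[of 0 b 0] by (simp add: psd_def less_eq_complex_def)
qed

text \<open>With last coordinate 1, the two linear expressions inside the completed squares can be
  made 0. The form is then the Schur complement, that is, the determinant divided by the leading 2
  by 2 minor.\<close>

lemma mat3_hform_det3:
  assumes "0 < a" "cmod u < a"
  obtains x where "x 2 = 1"
    "of_real (a\<^sup>2 - (cmod u)\<^sup>2) * hform 3 (mat3 (of_real a) u v w) x = of_real (det3 a u v w)"
proof -
  define d where "d = a\<^sup>2 - (cmod u)\<^sup>2"
  define e where "e = of_real a * w - cnj u * v"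
  define x1 where "x1 = - e / of_real d"
  define x where "x i = (if i = 2 then 1 else if i = 1 then x1 else - (u * x1 + v) / of_real a)" for i :: nat
  have "d > 0" unfolding d_def using assms by (simp add: power_strict_mono)
  then have x: "x 2 = 1" "of_real a * x 0 + u * x 1 + v * x 2 = 0" "of_real d * x 1 + e * x 2 = 0"
    using assms by (auto simp: x_def x1_def)
  have "of_real (a * d) * hform 3 (mat3 (of_real a) u v w) x = of_real (a * det3 a u v w)"
    using mat3_hform_identity[of a u v w x] x by (simp flip: d_def e_def)
  then have "of_real d * hform 3 (mat3 (of_real a) u v w) x = of_real (det3 a u v w)"
    using assms by simp
  then show ?thesis using x(1) that unfolding d_def by blast
qed

text \<open>The bound on \<open>u\<close> makes the leading minors of sizes 1 and 2 positive, so the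
  determinant alone decides.\<close>

lemma pd_mat3_iff:
  assumes "0 < a" "cmod u < a"
  shows "pd 3 (mat3 (of_real a) u v w) \<longleftrightarrow> 0 < det3 a u v w"
proof
  assume P: "pd 3 (mat3 (of_real a) u v w)"
  obtain x where x: "x 2 = 1"
    "of_real (a\<^sup>2 - (cmod u)\<^sup>2) * hform 3 (mat3 (of_real a) u v w) x = of_real (det3 a u v w)"
    using mat3_hform_det3[OF assms] .
  have "0 < hform 3 (mat3 (of_real a) u v w) x"
    by (rule pdD[OF P, of 2]) (auto simp: x(1))
  moreover have "0 < a\<^sup>2 - (cmod u)\<^sup>2" using assms by (simp add: power_strict_mono)
  ultimately have "0 < complex_of_real (det3 a u v w)"
    unfolding x(2)[symmetric] by (simp add: less_complex_def del: of_real_diff)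
  then show "0 < det3 a u v w" by (simp add: less_complex_def)
next
  assume det: "0 < det3 a u v w"
  define d where "d = a\<^sup>2 - (cmod u)\<^sup>2"
  define e where "e = of_real a * w - cnj u * v"
  have d: "0 < d" using assms by (simp add: d_def power_strict_mono)
  show "pd 3 (mat3 (of_real a) u v w)"
    unfolding pd_def
  proof (intro conjI herm_mat3 allI impI)
    fix x :: "nat \<Rightarrow> complex" assume x: "\<exists>i<3. x i \<noteq> 0"
    then have x: "x 0 \<noteq> 0 \<or> x 1 \<noteq> 0 \<or> x 2 \<noteq> 0" by (auto simp: numeral_3_eq_3 less_Suc_eq numeral_2_eq_2)
    have "0 < d * (cmod (of_real a * x 0 + u * x 1 + v * x 2))\<^sup>2 +
      (cmod (of_real d * x 1 + e * x 2))\<^sup>2 + a * det3 a u v w * (cmod (x 2))\<^sup>2"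
    proof (cases "x 2 = 0")
      case False
      then show ?thesis using d det assms by (intro add_nonneg_pos add_nonneg_nonneg mult_pos_pos mult_nonneg_nonneg) auto
    next
      case True
      then show ?thesis
      proof (cases "x 1 = 0")
        case False
        then show ?thesis using d True by (simp add: add_nonneg_pos)
      next
        case True
        then show ?thesis using x \<open>x 2 = 0\<close> d assms by simp
      qed
    qed
    then have "0 < of_real (a * d) * hform 3 (mat3 (of_real a) u v w) x"
      unfolding d_def e_def mat3_hform_identity by (simp add: less_complex_def del: of_real_add)
    then show "0 < hform 3 (mat3 (of_real a) u v w) x"
      using mult_pos_pos[OF assms(1) d] by (auto simp: less_complex_def zero_less_mult_iff)
  qed
qed

text \<open>The strict bound on \<open>u\<close> matters: a nonnegative determinant decides
  semidefiniteness only because the smaller leading minors are positive.\<close>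

lemma psd_mat3_iff:
  assumes "0 < a" "cmod u < a"
  shows "psd 3 (mat3 (of_real a) u v w) \<longleftrightarrow> 0 \<le> det3 a u v w"
proof
  assume P: "psd 3 (mat3 (of_real a) u v w)"
  obtain x where x:
    "of_real (a\<^sup>2 - (cmod u)\<^sup>2) * hform 3 (mat3 (of_real a) u v w) x = of_real (det3 a u v w)"
    using mat3_hform_det3[OF assms] .
  have "0 \<le> hform 3 (mat3 (of_real a) u v w) x" using P unfolding psd_def by blast
  moreover have "0 < a\<^sup>2 - (cmod u)\<^sup>2" using assms by (simp add: power_strict_mono)
  ultimately have "0 \<le> complex_of_real (det3 a u v w)"
    unfolding x[symmetric] by (simp add: less_eq_complex_def del: of_real_diff)
  then show "0 \<le> det3 a u v w" by (simp add: less_eq_complex_def)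
next
  assume det: "0 \<le> det3 a u v w"
  define d where "d = a\<^sup>2 - (cmod u)\<^sup>2"
  define e where "e = of_real a * w - cnj u * v"
  have d: "0 < d" using assms by (simp add: d_def power_strict_mono)
  show "psd 3 (mat3 (of_real a) u v w)"
    unfolding psd_def
  proof (intro conjI herm_mat3 allI)
    fix x :: "nat \<Rightarrow> complex"
    have "0 \<le> d * (cmod (of_real a * x 0 + u * x 1 + v * x 2))\<^sup>2 +
      (cmod (of_real d * x 1 + e * x 2))\<^sup>2 + a * det3 a u v w * (cmod (x 2))\<^sup>2"
      using d det assms by simp
    then have "0 \<le> of_real (a * d) * hform 3 (mat3 (of_real a) u v w) x"
      unfolding d_def e_def mat3_hform_identity by (simp add: less_eq_complex_def del: of_real_add)
    then show "0 \<le> hform 3 (mat3 (of_real a) u v w) x"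
      using mult_pos_pos[OF assms(1) d] by (auto simp: less_eq_complex_def zero_le_mult_iff)
  qed
qed

subsection \<open>Characters of the unit circle\<close>

text \<open>Integrating the functional equation shows that \<open>g\<close> is differentiable.\<close>

lemma continuous_exponential_law:
  fixes g :: "real \<Rightarrow> complex"
  assumes cont: "continuous_on UNIV g"
    and mult: "\<And>s t. g (s + t) = g s * g t"
    and one: "g 0 = 1"
  obtains c where "\<And>t. g t = exp (c * of_real t)"
proof -
  \<comment> \<open>All arguments of \<open>G\<close> below lie in (-1, 2), well inside this
    interval, so that two-sided derivatives are at hand.\<close>
  have "continuous_on {-3..3} g" using cont continuous_on_subset by blast
  then obtain G where G: "\<And>x. x \<in> {-3..3} \<Longrightarrow> (G has_vector_derivative g x) (at x within {-3..3})"
    using antiderivative_continuous by blast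
  have dG: "(G has_vector_derivative g x) (at x)" if "-3 < x" "x < 3" for x
    using G[of x] that by (simp add: at_within_Icc_at)
  \<comment> \<open>A nonzero integral of \<open>g\<close> is needed as a divisor. If there were
    none, \<open>G\<close> would be constant around 1/2, so g(1/2) = 0, against g(1/2) g(-1/2) =
    1.\<close>
  have "\<exists>d. 0 < d \<and> d < 1 \<and> G d \<noteq> G 0"
  proof (rule ccontr)
    assume "\<not> ?thesis"
    then have const: "G d = G 0" if "0 < d" "d < 1" for d using that by blast
    have "(G has_vector_derivative g (1/2)) (at (1/2))" by (rule dG) auto
    moreover have "(G has_vector_derivative 0) (at (1/2))"
    proof (rule has_vector_derivative_transform_within_open[where S = "{0<..<1}" and f = "\<lambda>_. G 0"])
      show "((\<lambda>_. G 0) has_vector_derivative 0) (at (1/2))" by (rule has_vector_derivative_const)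
    qed (use const in auto)
    ultimately have "g (1/2) = 0" by (rule vector_derivative_unique_at)
    then show False using mult[of "1/2" "1/2"] mult[of "1/2" "-1/2"] one by simp
  qed
  then obtain d where d: "0 < d" "d < 1" "G d \<noteq> G 0" by blast
  \<comment> \<open>In terms of integrals: \<open>g t\<close> times the integral over [0, d] is the
    integral over [t, t + d]. Division expresses \<open>g\<close> near 0 through the differentiable
    \<open>G\<close>.\<close>
  have law: "g t * (G d - G 0) = G (t + d) - G t" if t: "-1 < t" "t < 1" for t
  proof -
    define K where "K s = G (t + s) - g t * G s" for s
    have "(K has_vector_derivative 0) (at s within {0..d})" if "s \<in> {0..d}" for s
    proof -
      have "((G \<circ> (\<lambda>s. t + s)) has_vector_derivative 1 *\<^sub>R g (t + s)) (at s)"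
      proof (rule vector_diff_chain_at)
        show "((\<lambda>s. t + s) has_vector_derivative 1) (at s)"
          by (auto intro!: derivative_eq_intros)
        show "(G has_vector_derivative g (t + s)) (at (t + s))"
          by (rule dG) (use that t d in auto)
      qed
      moreover have "((\<lambda>s. g t * G s) has_vector_derivative g t * g s) (at s)"
        by (rule has_vector_derivative_mult_right, rule dG) (use that d in auto)
      ultimately have "(K has_vector_derivative 1 *\<^sub>R g (t + s) - g t * g s) (at s)"
        unfolding K_def o_def by (rule has_vector_derivative_diff)
      then show ?thesis using mult[of t s] by (simp add: has_vector_derivative_at_within)
    qed
    then obtain k where "\<And>s. s \<in> {0..d} \<Longrightarrow> K s = k"
      using has_vector_derivative_zero_constant[of "{0..d}" K] by auto
    then have "K d = K 0" using d by auto
    then show ?thesis using mult[of t 0] one unfolding K_def by (simp add: algebra_simps)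
  qed
  define c where "c = (g d - 1) / (G d - G 0)"
  have d0: "(g has_vector_derivative c) (at 0)"
  proof (rule has_vector_derivative_transform_within_open[where S = "{-1<..<1}"])
    have "((G \<circ> (\<lambda>t. t + d)) has_vector_derivative 1 *\<^sub>R g (0 + d)) (at 0)"
    proof (rule vector_diff_chain_at)
      show "((\<lambda>t. t + d) has_vector_derivative 1) (at 0)"
        by (auto intro!: derivative_eq_intros)
      show "(G has_vector_derivative g (0 + d)) (at (0 + d))"
        by (rule dG) (use d in auto)
    qed
    then have "((\<lambda>t. G (t + d) - G t) has_vector_derivative g d - 1) (at 0)"
      using has_vector_derivative_diff[OF _ dG[of 0]] one by (fastforce simp: o_def)
    then show "((\<lambda>t. (G (t + d) - G t) / (G d - G 0)) has_vector_derivative c) (at 0)"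
      unfolding c_def by (rule has_vector_derivative_divide)
    show "\<And>t. t \<in> {-1<..<1} \<Longrightarrow> (G (t + d) - G t) / (G d - G 0) = g t"
      using law d by (simp add: field_simps)
  qed auto
  have dg: "(g has_vector_derivative c * g t) (at t)" for t
  proof -
    have "((g \<circ> (\<lambda>s. s - t)) has_vector_derivative 1 *\<^sub>R c) (at t)"
      by (rule vector_diff_chain_at) (use d0 in \<open>auto intro!: derivative_eq_intros\<close>)
    then have "((\<lambda>s. g t * g (s - t)) has_vector_derivative g t * c) (at t)"
      by (intro has_vector_derivative_mult_right) (simp add: o_def)
    moreover have "(\<lambda>s. g t * g (s - t)) = g"
    proof
      fix s
      have "g (t + (s - t)) = g t * g (s - t)" by (rule mult)
      then show "g t * g (s - t) = g s" by simp
    qed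
    ultimately show ?thesis by (simp only: mult.commute)
  qed
  define K where "K t = g t * exp (- c * of_real t)" for t
  have "(K has_vector_derivative 0) (at t within UNIV)" for t
  proof -
    have "((\<lambda>t. exp (- c * of_real t)) has_vector_derivative - c * exp (- c * of_real t)) (at t)"
      by (auto intro!: derivative_eq_intros has_vector_derivative_real_field simp: mult.commute)
    from has_vector_derivative_mult[OF dg[of t] this] show ?thesis
      unfolding K_def by (simp add: mult_ac)
  qed
  then obtain k where k: "\<And>t. K t = k"
    using has_vector_derivative_zero_constant[of UNIV K] by auto
  have "k = 1" using k[of 0] one by (simp add: K_def)
  have "g t = exp (c * of_real t)" for t
    using k[of t] unfolding K_def \<open>k = 1\<close> by (simp add: exp_minus field_simps)
  then show ?thesis using that by blast
qed

text \<open>Along \<open>cis\<close> the character becomes \<open>cis (k * t)\<close> for a real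
  \<open>k\<close>. Periodicity makes \<open>k\<close> an integer, and the trivial kernel makes 1 /
  k an integer, so \<open>k\<close> is 1 or -1. Continuity at 1 is phrased through real parts
  because determinants only see those.\<close>

lemma circle_character:
  fixes \<phi> :: "complex \<Rightarrow> complex"
  assumes norm: "\<And>u. cmod u = 1 \<Longrightarrow> cmod (\<phi> u) = 1"
    and mult: "\<And>u v. cmod u = 1 \<Longrightarrow> cmod v = 1 \<Longrightarrow> \<phi> (u * v) = \<phi> u * \<phi> v"
    and cont: "\<And>e. e < 1 \<Longrightarrow> \<exists>d<1. \<forall>u. cmod u = 1 \<and> d < Re u \<longrightarrow> e < Re (\<phi> u)"
    and inj: "\<And>u. cmod u = 1 \<Longrightarrow> \<phi> u = 1 \<Longrightarrow> u = 1"
  shows "(\<forall>u. cmod u = 1 \<longrightarrow> \<phi> u = u) \<or> (\<forall>u. cmod u = 1 \<longrightarrow> \<phi> u = cnj u)"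
proof -
  define g where "g t = \<phi> (cis t)" for t
  have g_add: "g (s + t) = g s * g t" for s t
    unfolding g_def by (simp add: mult flip: cis_mult)
  have g_norm: "cmod (g t) = 1" for t
    unfolding g_def by (simp add: norm)
  have g0: "g 0 = 1" using g_add[of 0 0] g_norm[of 0] by auto
  have "((\<lambda>h. Re (g h)) \<longlongrightarrow> 1) (at 0)"
  proof (rule order_tendstoI)
    fix e :: real assume "e < 1"
    then obtain d where d: "d < 1" "\<And>u. cmod u = 1 \<Longrightarrow> d < Re u \<Longrightarrow> e < Re (\<phi> u)"
      using cont by blast
    have "(cos \<longlongrightarrow> cos 0) (at (0::real))" by (intro tendsto_intros)
    then have "\<forall>\<^sub>F h in at (0::real). d < cos h"
      using d(1) by (intro order_tendstoD(1)) auto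
    then show "\<forall>\<^sub>F h in at 0. e < Re (g h)"
      by eventually_elim (use d(2) in \<open>auto simp: g_def\<close>)
  next
    fix e :: real assume "1 < e"
    then show "\<forall>\<^sub>F h in at 0. Re (g h) < e"
      using complex_Re_le_cmod g_norm by (intro always_eventually allI) (metis le_less_trans)
  qed
  then have "((\<lambda>h. 2 - 2 * Re (g h)) \<longlongrightarrow> 2 - 2 * 1) (at 0)"
    by (intro tendsto_intros)
  \<comment> \<open>On the unit circle a real part close to 1 already forces closeness to 1.\<close>
  moreover have "2 - 2 * Re (g h) = (cmod (g h - 1))\<^sup>2" for h
  proof -
    have "(Re (g h))\<^sup>2 + (Im (g h))\<^sup>2 = 1" using g_norm[of h] by (metis cmod_power2 one_power2)
    then show ?thesis by (simp add: cmod_power2 power2_diff)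
  qed
  ultimately have "((\<lambda>h. (cmod (g h - 1))\<^sup>2) \<longlongrightarrow> 0) (at 0)" by simp
  then have "((\<lambda>h. sqrt ((cmod (g h - 1))\<^sup>2)) \<longlongrightarrow> sqrt 0) (at 0)" by (rule tendsto_real_sqrt)
  then have "((\<lambda>h. cmod (g h - 1)) \<longlongrightarrow> 0) (at 0)" by simp
  then have "((\<lambda>h. g h - 1) \<longlongrightarrow> 0) (at 0)" by (rule tendsto_norm_zero_cancel)
  then have lim: "(g \<longlongrightarrow> 1) (at 0)" by (rule LIM_zero_cancel)
  have "continuous_on UNIV g"
  proof -
    have "isCont g t" for t
      unfolding isCont_iff g_add using tendsto_mult[OF tendsto_const lim, of "g t"] by simp
    then show ?thesis by (simp add: continuous_at_imp_continuous_on)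
  qed
  then obtain c where c: "\<And>t. g t = exp (c * of_real t)"
    using continuous_exponential_law[OF _ g_add g0] by blast
  define k where "k = Im c"
  have "Re c = 0" using g_norm[of 1] c[of 1] by simp
  then have "c = \<i> * of_real k" by (simp add: complex_eq_iff k_def)
  then have g_cis: "g t = cis (k * t)" for t
    by (simp add: c cis_conv_exp mult.assoc)
  have g_inj: "cis t = 1" if "cis (k * t) = 1" for t
    using inj[of "cis t"] that g_cis[of t] by (simp add: g_def)
  have cis_1: "\<exists>m::int. x = m" if "cis (2 * pi * x) = 1" for x
  proof -
    have "cos (2 * pi * x) = 1" using that by (metis cis.sel(1) one_complex.sel(1))
    then show ?thesis using cos_one_2pi_int[of "2 * pi * x"] by auto
  qed
  have rep: "u = cis (Arg u)" if "cmod u = 1" for u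
    using that by (metis cis_Arg div_by_1 norm_eq_zero of_real_1 sgn_eq zero_neq_one)
  have "k \<noteq> 0" using g_inj[of pi] by auto
  have "g (2 * pi) = 1" using g0 by (simp add: g_def)
  then have "cis (2 * pi * k) = 1" by (simp add: g_cis mult_ac)
  then obtain m where m: "k = of_int m" using cis_1 by blast
  \<comment> \<open>At the parameter 2 pi / k the image is 1, so injectivity applies.\<close>
  have "cis (2 * pi * (1 / k)) = 1"
    by (rule g_inj) (use \<open>k \<noteq> 0\<close> in \<open>simp add: complex_eq_iff\<close>)
  then obtain m' where "1 / k = of_int m'" using cis_1 by blast
  then have "real_of_int (m * m') = 1" using m \<open>k \<noteq> 0\<close> by (simp add: field_simps)
  then have "m * m' = 1" by linarith
  then have "m = 1 \<or> m = -1" by (metis zmult_eq_1_iff)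
  then show ?thesis
  proof
    assume "m = 1"
    then have "\<phi> (cis t) = cis t" for t using g_cis[of t] m by (simp add: g_def)
    then show ?thesis using rep by metis
  next
    assume "m = -1"
    then have "\<phi> (cis t) = cnj (cis t)" for t using g_cis[of t] m by (simp add: g_def cis_cnj)
    then show ?thesis using rep by metis
  qed
qed

subsection \<open>Monotone functions on the radii\<close>

text \<open>Monotonicity leaves only a possible jump to the right of \<open>r\<close>. Let
  \<open>L\<close> be the infimum of \<open>F\<close> over (r, b]. For each z there, some y > r lies
  below the geometric mean of r and z, so L^2 <= F(y)^2 <= F(r) F(z). Taking the infimum over z
  gives L^2 <= F(r) L, hence L <= F(r).\<close>

lemma right_continuous_of_log_midconvex:
  fixes F :: "real \<Rightarrow> real"
  assumes J: "is_interval J" "J \<subseteq> {0<..}"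
    and pos: "\<And>x. x \<in> J \<Longrightarrow> 0 < F x"
    and mono: "\<And>x y. x \<in> J \<Longrightarrow> y \<in> J \<Longrightarrow> x < y \<Longrightarrow> F x < F y"
    and mid: "\<And>x y z. x \<in> J \<Longrightarrow> y \<in> J \<Longrightarrow> z \<in> J \<Longrightarrow> y\<^sup>2 < x * z \<Longrightarrow> (F y)\<^sup>2 \<le> F x * F z"
    and r: "r \<in> J" "b \<in> J" "r < b"
  shows "(F \<longlongrightarrow> F r) (at_right r)"
proof (rule order_tendstoI)
  have J_Icc: "y \<in> J" if "r \<le> y" "y \<le> b" for y
    using J(1) r that mem_is_interval_1_I by blast
  fix e assume "e < F r"
  then show "\<forall>\<^sub>F y in at_right r. e < F y"
    unfolding eventually_at_right_field
    using r(3) J_Icc mono[OF r(1)] by (intro exI[of _ b]) (meson less_imp_le less_trans)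
next
  have J_Icc: "y \<in> J" if "r \<le> y" "y \<le> b" for y
    using J(1) r that mem_is_interval_1_I by blast
  have r0: "0 < r" using J r by auto
  fix e assume e: "F r < e"
  have "\<exists>y\<in>{r<..b}. F y < e"
  proof (rule ccontr)
    assume "\<not> ?thesis"
    then have ge: "e \<le> F y" if "y \<in> {r<..b}" for y using that by (meson not_less)
    define L where "L = Inf (F ` {r<..b})"
    have bdd: "bdd_below (F ` {r<..b})" using ge by (intro bdd_belowI2)
    have ne: "F ` {r<..b} \<noteq> {}" using r by auto
    have Le: "e \<le> L" unfolding L_def by (rule cInf_greatest[OF ne]) (use ge in auto)
    then have L0: "0 < L" using e pos[OF r(1)] by linarith
    have "L\<^sup>2 / F r \<le> L"
    proof (subst (2) L_def, rule cInf_greatest[OF ne], clarify)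
      fix z assume z: "z \<in> {r<..b}"
      have "r < sqrt (r * z)" using r0 z by (intro real_less_rsqrt) (simp add: power2_eq_square)
      then obtain y where y: "r < y" "y < sqrt (r * z)" using dense by blast
      have "y\<^sup>2 < r * z" using y r0 by (metis less_le_trans less_imp_le real_sqrt_less_iff real_sqrt_abs abs_of_pos less_trans)
      moreover have "r * z \<le> z * z" using z r0 by (intro mult_right_mono) auto
      ultimately have "y < z" using r0 y z by (smt (verit) greaterThanAtMost_iff power2_eq_square power2_less_imp_less)
      then have yJ: "y \<in> J" "y \<in> {r<..b}" using J_Icc y z by auto
      have "L \<le> F y" unfolding L_def using yJ by (intro cInf_lower[OF _ bdd]) auto
      then have "L\<^sup>2 \<le> (F y)\<^sup>2" using L0 by (intro power_mono) auto
      also have "\<dots> \<le> F r * F z" using mid[OF r(1) yJ(1) _ \<open>y\<^sup>2 < r * z\<close>] J_Icc z by auto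
      finally show "L\<^sup>2 / F r \<le> F z" using pos[OF r(1)] by (simp add: field_simps)
    qed
    then have "L * L \<le> F r * L" using pos[OF r(1)] by (simp add: field_simps power2_eq_square)
    then have "L \<le> F r" using L0 by simp
    then show False using Le e by linarith
  qed
  then obtain y where y: "r < y" "y \<le> b" "F y < e" by auto
  show "\<forall>\<^sub>F y in at_right r. F y < e"
    unfolding eventually_at_right_field
  proof (intro exI[of _ y] conjI allI impI)
    fix x assume "r < x" "x < y"
    then have "F x < F y" using mono J_Icc y by auto
    then show "F x < e" using y by linarith
  qed (use y in auto)
qed

text \<open>The mirror image of the previous argument: with the supremum \<open>L\<close> over [b,
  r) and y between the geometric mean of r and z and r itself, F(r) F(z) <= L^2, hence F(r) <=
  L.\<close>

lemma left_approx_of_log_midconcave: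
  fixes F :: "real \<Rightarrow> real"
  assumes J: "is_interval J" "J \<subseteq> {0<..}"
    and pos: "\<And>x. x \<in> J \<Longrightarrow> 0 < F x"
    and mid: "\<And>x y z. x \<in> J \<Longrightarrow> y \<in> J \<Longrightarrow> z \<in> J \<Longrightarrow> x * z < y\<^sup>2 \<Longrightarrow> F x * F z \<le> (F y)\<^sup>2"
    and r: "r \<in> J" "b \<in> J" "b < r" and e: "e < F r"
  shows "\<exists>y\<in>{b..<r}. e < F y"
proof (rule ccontr)
  assume "\<not> ?thesis"
  then have le: "F y \<le> e" if "y \<in> {b..<r}" for y using that by (meson not_less)
  have J_Icc: "y \<in> J" if "b \<le> y" "y \<le> r" for y
    using J(1) r that mem_is_interval_1_I by blast
  have b0: "0 < b" using J r by auto
  define L where "L = Sup (F ` {b..<r})"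
  have bdd: "bdd_above (F ` {b..<r})" using le by (intro bdd_aboveI2)
  have ne: "F ` {b..<r} \<noteq> {}" using r by auto
  have Le: "L \<le> e" unfolding L_def by (rule cSup_least[OF ne]) (use le in auto)
  have up: "F y \<le> L" if "y \<in> {b..<r}" for y unfolding L_def using that by (intro cSup_upper[OF _ bdd]) auto
  have "0 < F b" using pos r by auto
  also have "F b \<le> L" using up r by auto
  finally have L0: "0 < L" .
  have "L \<le> L\<^sup>2 / F r"
  proof (subst L_def, rule cSup_least[OF ne], clarify)
    fix z assume z: "z \<in> {b..<r}"
    have "sqrt (r * z) < r" using b0 z by (intro real_less_lsqrt) (simp_all add: power2_eq_square)
    then obtain y where y: "sqrt (r * z) < y" "y < r" using dense by blast
    have "0 \<le> sqrt (r * z)" using b0 z r by simp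
    then have "r * z < y\<^sup>2" using y b0 z r by (smt (verit) real_less_lsqrt real_sqrt_less_iff real_sqrt_abs)
    moreover have "z * z \<le> r * z" using z b0 by (intro mult_right_mono) auto
    ultimately have "z < y" using y \<open>0 \<le> sqrt (r * z)\<close> by (smt (verit) power2_eq_square power2_less_imp_less)
    then have yJ: "y \<in> J" "y \<in> {b..<r}" using J_Icc y z by auto
    have "F r * F z \<le> (F y)\<^sup>2" using mid[OF r(1) yJ(1) _ \<open>r * z < y\<^sup>2\<close>] J_Icc z by auto
    also have "(F y)\<^sup>2 \<le> L\<^sup>2" using up[OF yJ(2)] pos[OF yJ(1)] by (intro power_mono) auto
    finally show "F z \<le> L\<^sup>2 / F r" using pos[OF r(1)] by (simp add: field_simps)
  qed
  then have "F r * L \<le> L * L" using pos[OF r(1)] by (simp add: field_simps power2_eq_square)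
  then have "F r \<le> L" using L0 by simp
  then show False using Le e by linarith
qed

subsection \<open>Rigidity of the phase and of the radial part\<close>

text \<open>This is the determinant with diagonal \<open>y\<close> and all off-diagonal entries
  \<open>x\<close>; the double root at y = x appears in the factorization.\<close>

lemma cubic_pos:
  fixes x y :: real
  assumes "0 < x" "x < y"
  shows "0 < y ^ 3 + 2 * x ^ 3 - 3 * y * x\<^sup>2"
proof -
  have "0 < (y - x)\<^sup>2 * (y + 2 * x)" using assms by simp
  also have "\<dots> = y ^ 3 + 2 * x ^ 3 - 3 * y * x\<^sup>2"
    by (simp add: algebra_simps power2_eq_square power3_eq_cube)
  finally show ?thesis .
qed

text \<open>The common ground of both cases. The conclusions of \<open>det_pos\<close> and
  \<open>det_neg\<close> are weak because the definite case transfers the sign condition 0 < det and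
  the semidefinite case 0 <= det. \<open>f_mult\<close> says that the phase at \<open>u * w\<close>
  on the larger radius is the product of the phases at \<open>u\<close> and \<open>w\<close> on the
  smaller one.\<close>

locale radial_transfer =
  fixes J :: "real set" and F :: "real \<Rightarrow> real" and f :: "complex \<Rightarrow> complex"
  assumes J_interval: "is_interval J" and J_pos: "J \<subseteq> {0<..}" and nontrivial: "\<exists>r\<in>J. \<exists>s\<in>J. r < s"
    and F_pos: "\<And>r. r \<in> J \<Longrightarrow> 0 < F r"
    and F_mono: "\<And>r s. r \<in> J \<Longrightarrow> s \<in> J \<Longrightarrow> r < s \<Longrightarrow> F r < F s"
    and F_right: "\<And>r s. r \<in> J \<Longrightarrow> s \<in> J \<Longrightarrow> r < s \<Longrightarrow> (F \<longlongrightarrow> F r) (at_right r)"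
    and f_real: "\<And>r. r \<in> J \<Longrightarrow> f (of_real r) = of_real (F r)"
    and f_norm: "\<And>w. cmod w \<in> J \<Longrightarrow> cmod (f w) = F (cmod w)"
    and f_mult: "\<And>r s u w. r \<in> J \<Longrightarrow> s \<in> J \<Longrightarrow> r < s \<Longrightarrow> cmod u = 1 \<Longrightarrow> cmod w = 1 \<Longrightarrow>
      f (of_real r * u) * f (of_real r * w) * cnj (f (of_real s * (u * w))) = of_real ((F r)\<^sup>2 * F s)"
    and det_pos: "\<And>r s u. r \<in> J \<Longrightarrow> s \<in> J \<Longrightarrow> r < s \<Longrightarrow> cmod u = 1 \<Longrightarrow>
      0 < s ^ 3 + 2 * r ^ 3 * Re u - 3 * s * r\<^sup>2 \<Longrightarrow>
      0 \<le> F s ^ 3 + 2 * (F r)\<^sup>2 * Re (f (of_real r * u)) - 3 * F s * (F r)\<^sup>2"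
    and det_neg: "\<And>r s u. r \<in> J \<Longrightarrow> s \<in> J \<Longrightarrow> r < s \<Longrightarrow> cmod u = 1 \<Longrightarrow>
      s ^ 3 + 2 * r ^ 3 * Re u - 3 * s * r\<^sup>2 < 0 \<Longrightarrow>
      F s ^ 3 + 2 * (F r)\<^sup>2 * Re (f (of_real r * u)) - 3 * F s * (F r)\<^sup>2 \<le> 0"
begin

section \<open>One phase character for all radii\<close>

lemma phase_product:
  assumes "r \<in> J" "s \<in> J" "r < s" "cmod u = 1" "cmod w = 1"
  shows "f (of_real r * u) / of_real (F r) * (f (of_real r * w) / of_real (F r)) = f (of_real s * (u * w)) / of_real (F s)"
proof -
  let ?z = "f (of_real s * (u * w))"
  have "cmod (of_real s * (u * w)) = s" using assms J_pos by (auto simp: norm_mult)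
  then have "cmod ?z = F s" using f_norm assms(2) by metis
  then have z: "?z * cnj ?z = (of_real (F s))\<^sup>2" by (simp add: complex_norm_square[symmetric])
  have "f (of_real r * u) * f (of_real r * w) * (?z * cnj ?z) = of_real ((F r)\<^sup>2 * F s) * ?z"
    using f_mult[OF assms] by (simp add: mult_ac)
  moreover have "of_real (F s) \<noteq> (0::complex)" "of_real (F r) \<noteq> (0::complex)"
    using F_pos assms by (metis of_real_eq_0_iff less_irrefl)+
  ultimately show ?thesis unfolding z by (simp add: field_simps power2_eq_square)
qed

text \<open>The chosen radius has another one to its right, as \<open>phase_product\<close> and
  right continuity demand; in the semidefinite case \<open>J\<close> may have a maximum.\<close>

definition base :: real where "base = (SOME r. r \<in> J \<and> (\<exists>s\<in>J. r < s))"

lemma base: "base \<in> J" "\<exists>s\<in>J. base < s"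
proof -
  have "\<exists>r. r \<in> J \<and> (\<exists>s\<in>J. r < s)" using nontrivial by blast
  then show "base \<in> J" "\<exists>s\<in>J. base < s" unfolding base_def by (metis (mono_tags, lifting) someI_ex)+
qed

definition phase :: "complex \<Rightarrow> complex" where
  "phase u = f (of_real base * u) / of_real (F base)"

text \<open>Taking the second unit factor to be 1, where \<open>f\<close> is real and positive,
  shows that the phases on any two radii coincide.\<close>

lemma f_polar:
  assumes r: "r \<in> J" and u: "cmod u = 1"
  shows "f (of_real r * u) = of_real (F r) * phase u"
proof -
  have same: "f (of_real r * u) / of_real (F r) = f (of_real s * u) / of_real (F s)"
    if "r \<in> J" "s \<in> J" "r < s" for r s
    using phase_product[OF that u, of 1] f_real[OF that(1)] F_pos[OF that(1)] by simp
  have "f (of_real r * u) / of_real (F r) = phase u"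
    unfolding phase_def
  proof (cases r base rule: linorder_cases)
    case less then show "f (of_real r * u) / of_real (F r) = f (of_real base * u) / of_real (F base)"
      by (rule same[OF r base(1)])
  next
    case greater then show "f (of_real r * u) / of_real (F r) = f (of_real base * u) / of_real (F base)"
      by (rule same[OF base(1) r, symmetric])
  qed simp
  then show ?thesis using F_pos[OF r] by (simp add: field_simps)
qed

lemma phase_mult:
  assumes "cmod u = 1" "cmod v = 1"
  shows "phase (u * v) = phase u * phase v"
proof -
  obtain s where s: "s \<in> J" "base < s" using base by blast
  have "cmod (u * v) = 1" using assms by (simp add: norm_mult)
  then show ?thesis
    using phase_product[OF base(1) s assms] f_polar[OF s(1), of "u * v"] F_pos[OF s(1)]
    unfolding phase_def by simp
qed

lemma phase_norm: "cmod u = 1 \<Longrightarrow> cmod (phase u) = 1"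
  using f_norm[of "of_real base * u"] base(1) J_pos F_pos[OF base(1)]
  by (auto simp: phase_def norm_divide norm_mult)

lemma Re_f: "r \<in> J \<Longrightarrow> cmod u = 1 \<Longrightarrow> Re (f (of_real r * u)) = F r * Re (phase u)"
  by (simp add: f_polar)

lemma eventually_right:
  assumes "r \<in> J" "s \<in> J" "r < s"
  shows "\<forall>\<^sub>F y in at_right r. y \<in> J \<and> r < y"
  unfolding eventually_at_right_field
  using assms J_interval mem_is_interval_1_I less_imp_le by (intro exI[of _ s]) blast

text \<open>With diagonal \<open>y\<close> the determinant is positive exactly when Re u exceeds a
  threshold, and the image has a threshold of the same shape with \<open>F\<close> in place of the
  radii. As \<open>y\<close> decreases to \<open>base\<close> the image threshold tends to 1 by
  right continuity of \<open>F\<close>, so it can be pushed above \<open>e\<close>, while the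
  original one stays below 1 for each such \<open>y\<close>.\<close>

lemma phase_cont:
  assumes "e < 1"
  shows "\<exists>d<1. \<forall>u. cmod u = 1 \<and> d < Re u \<longrightarrow> e < Re (phase u)"
proof -
  let ?r = base
  obtain s where s: "s \<in> J" "base < s" using base by blast
  have r0: "0 < ?r" using base J_pos by auto
  have Fr: "0 < F ?r" using F_pos base by blast
  have "((\<lambda>y. (3 * F y * (F ?r)\<^sup>2 - F y ^ 3) / (2 * F ?r ^ 3)) \<longlongrightarrow>
    (3 * F ?r * (F ?r)\<^sup>2 - F ?r ^ 3) / (2 * F ?r ^ 3)) (at_right ?r)"
    using Fr by (intro tendsto_intros F_right[OF base(1) s]) auto
  moreover have "(3 * F ?r * (F ?r)\<^sup>2 - F ?r ^ 3) / (2 * F ?r ^ 3) = 1"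
    using Fr by (simp add: field_simps power2_eq_square power3_eq_cube)
  ultimately have "\<forall>\<^sub>F y in at_right ?r. e < (3 * F y * (F ?r)\<^sup>2 - F y ^ 3) / (2 * F ?r ^ 3)"
    using order_tendstoD(1) assms by fastforce
  with eventually_right[OF base(1) s]
  have "\<forall>\<^sub>F y in at_right ?r. (y \<in> J \<and> ?r < y) \<and> e < (3 * F y * (F ?r)\<^sup>2 - F y ^ 3) / (2 * F ?r ^ 3)"
    by (rule eventually_conj)
  then obtain y where y: "y \<in> J" "?r < y" "e < (3 * F y * (F ?r)\<^sup>2 - F y ^ 3) / (2 * F ?r ^ 3)"
    using eventually_happens'[OF trivial_limit_at_right_real] by blast
  define d where "d = (3 * y * ?r\<^sup>2 - y ^ 3) / (2 * ?r ^ 3)"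
  show ?thesis
  proof (intro exI[of _ d] conjI allI impI)
    show "d < 1" using cubic_pos[OF r0 y(2)] r0 by (simp add: d_def field_simps)
    fix u assume u: "cmod u = 1 \<and> d < Re u"
    then have "0 < y ^ 3 + 2 * ?r ^ 3 * Re u - 3 * y * ?r\<^sup>2"
      using r0 by (simp add: d_def field_simps)
    then have "0 \<le> F y ^ 3 + 2 * (F ?r)\<^sup>2 * (F ?r * Re (phase u)) - 3 * F y * (F ?r)\<^sup>2"
      using det_pos[OF base(1) y(1,2), of u] u Re_f[OF base(1)] by simp
    then have "(3 * F y * (F ?r)\<^sup>2 - F y ^ 3) / (2 * F ?r ^ 3) \<le> Re (phase u)"
      using Fr by (simp add: field_simps power2_eq_square power3_eq_cube)
    then show "e < Re (phase u)" using y(3) by linarith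
  qed
qed

text \<open>If u differs from 1, then Re u < 1, and the determinant tends to 2 r^3 (Re u - 1) < 0 as
  the diagonal decreases to r = \<open>base\<close>. But phase 1 makes the image determinant
  positive for every diagonal above r, by \<open>cubic_pos\<close>.\<close>

lemma phase_inj:
  assumes u: "cmod u = 1" "phase u = 1"
  shows "u = 1"
proof (rule ccontr)
  let ?r = base
  assume "u \<noteq> 1"
  obtain s where s: "s \<in> J" "base < s" using base by blast
  have r0: "0 < ?r" using base J_pos by auto
  have Fr: "0 < F ?r" using F_pos base by blast
  have "Re u \<le> 1" using complex_Re_le_cmod[of u] u by simp
  moreover have "Re u \<noteq> 1"
  proof
    assume "Re u = 1"
    moreover from this have "Im u = 0" using u(1) cmod_power2[of u] by simp
    ultimately show False using \<open>u \<noteq> 1\<close> by (simp add: complex_eq_iff)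
  qed
  ultimately have neg: "2 * ?r ^ 3 * (Re u - 1) < 0" using r0 by (simp add: mult_pos_neg)
  have "((\<lambda>y. y ^ 3 + 2 * ?r ^ 3 * Re u - 3 * y * ?r\<^sup>2) \<longlongrightarrow>
     ?r ^ 3 + 2 * ?r ^ 3 * Re u - 3 * ?r * ?r\<^sup>2) (at_right ?r)"
    by (intro tendsto_intros)
  moreover have "?r ^ 3 + 2 * ?r ^ 3 * Re u - 3 * ?r * ?r\<^sup>2 < 0"
    using neg by (simp add: algebra_simps power2_eq_square power3_eq_cube)
  ultimately have "\<forall>\<^sub>F y in at_right ?r. y ^ 3 + 2 * ?r ^ 3 * Re u - 3 * y * ?r\<^sup>2 < 0"
    by (rule order_tendstoD(2))
  with eventually_right[OF base(1) s]
  have "\<forall>\<^sub>F y in at_right ?r. (y \<in> J \<and> ?r < y) \<and> y ^ 3 + 2 * ?r ^ 3 * Re u - 3 * y * ?r\<^sup>2 < 0"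
    by (rule eventually_conj)
  then obtain y where y: "y \<in> J" "?r < y" "y ^ 3 + 2 * ?r ^ 3 * Re u - 3 * y * ?r\<^sup>2 < 0"
    using eventually_happens'[OF trivial_limit_at_right_real] by blast
  then have "F y ^ 3 + 2 * (F ?r)\<^sup>2 * (F ?r * Re (phase u)) - 3 * F y * (F ?r)\<^sup>2 \<le> 0"
    using det_neg[OF base(1) y(1,2), of u] u Re_f[OF base(1)] by simp
  then show False
    using cubic_pos[OF Fr F_mono[OF base(1) y(1,2)]] u(2) by (simp add: power2_eq_square power3_eq_cube)
qed

lemma phase_cases:
  "(\<forall>u. cmod u = 1 \<longrightarrow> phase u = u) \<or> (\<forall>u. cmod u = 1 \<longrightarrow> phase u = cnj u)"
  by (rule circle_character) (use phase_norm phase_mult phase_cont phase_inj in auto)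

section \<open>Linearity of the radial part\<close>

lemma Re_phase: "cmod u = 1 \<Longrightarrow> Re (phase u) = Re u"
  using phase_cases by auto

text \<open>Both \<open>t = s / r\<close> and \<open>t = F s / F r\<close> solve \<open>t\<^sup>3 - 3 t + 2 c = 0\<close>, where \<open>c\<close> is the real part at which the determinant changes sign; the cubic is injective on \<open>t > 1\<close>.\<close>

lemma F_ratio:
  assumes r: "r \<in> J" and s: "s \<in> J" and rs: "r < s" "s < 2 * r"
  shows "F s * r = F r * s"
proof -
  have r0: "0 < r" using r J_pos by auto
  have Fr: "0 < F r" using F_pos r by blast
  define c where "c = (3 * s * r\<^sup>2 - s ^ 3) / (2 * r ^ 3)"
  define P where "P x = F s ^ 3 + 2 * F r ^ 3 * x - 3 * F s * (F r)\<^sup>2" for x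
  have c: "s ^ 3 + 2 * r ^ 3 * c - 3 * s * r\<^sup>2 = 0" using r0 by (simp add: c_def)
  have c1: "c < 1" using cubic_pos[OF r0 rs(1)] r0 by (simp add: c_def field_simps)
  \<comment> \<open>This is where s < 2 r comes from: it puts the sign change \<open>c\<close> above
    -1, so that it is approached from both sides by real parts of unit numbers.\<close>
  have "(s + r)\<^sup>2 * (s - 2 * r) < 0" using rs r0 by (intro mult_pos_neg) auto
  moreover have "(s + r)\<^sup>2 * (s - 2 * r) = s ^ 3 - 2 * r ^ 3 - 3 * s * r\<^sup>2"
    by (simp add: algebra_simps power2_eq_square power3_eq_cube)
  ultimately have c2: "-1 < c" using r0 by (simp add: c_def field_simps)
  have lim: "(P \<longlongrightarrow> P c) (at c within A)" for A
    unfolding P_def by (intro tendsto_intros)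
  have P_eq: "P x = F s ^ 3 + 2 * (F r)\<^sup>2 * Re (f (of_real r * u)) - 3 * F s * (F r)\<^sup>2"
    if "cmod u = 1" "Re u = x" for u x
    using that Re_f[OF r, of u] Re_phase[of u] unfolding P_def
    by (simp add: power2_eq_square power3_eq_cube)
  have point: "\<exists>u. cmod u = 1 \<and> Re u = x" if "-1 < x" "x < 1" for x
  proof -
    have "x\<^sup>2 \<le> 1" using that by (simp add: abs_square_le_1)
    then show ?thesis by (intro exI[of _ "Complex x (sqrt (1 - x\<^sup>2))"]) (simp add: cmod_def)
  qed
  \<comment> \<open>Only weak signs are transferred, but \<open>P\<close> is affine: being
    nonnegative just right of \<open>c\<close> and nonpositive just left of it, it vanishes at
    \<open>c\<close>.\<close>
  have "0 \<le> P x" if x: "c < x" "x < 1" for x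
  proof -
    obtain u where u: "cmod u = 1" "Re u = x" using point x c2 by (meson less_trans)
    have "0 < s ^ 3 + 2 * r ^ 3 * x - 3 * s * r\<^sup>2"
    proof -
      have "2 * r ^ 3 * c < 2 * r ^ 3 * x" using x(1) r0 by simp
      then show ?thesis using c by linarith
    qed
    then show ?thesis unfolding P_eq[OF u] using det_pos[OF r s rs(1) u(1)] u(2) by simp
  qed
  then have "\<forall>\<^sub>F x in at_right c. 0 \<le> P x"
    unfolding eventually_at_right_field using c1 by blast
  then have P1: "0 \<le> P c"
    by (rule tendsto_lowerbound[OF lim]) simp
  have "P x \<le> 0" if x: "-1 < x" "x < c" for x
  proof -
    obtain u where u: "cmod u = 1" "Re u = x" using point x c1 by (meson less_trans)
    have "s ^ 3 + 2 * r ^ 3 * x - 3 * s * r\<^sup>2 < 0"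
    proof -
      have "2 * r ^ 3 * x < 2 * r ^ 3 * c" using x(2) r0 by simp
      then show ?thesis using c by linarith
    qed
    then show ?thesis unfolding P_eq[OF u] using det_neg[OF r s rs(1) u(1)] u(2) by simp
  qed
  then have "\<forall>\<^sub>F x in at_left c. P x \<le> 0"
    unfolding eventually_at_left_field using c2 by blast
  then have "P c \<le> 0"
    by (rule tendsto_upperbound[OF lim]) simp
  with P1 have P0: "P c = 0" by simp
  define t where "t = s / r"
  define T where "T = F s / F r"
  have t: "1 < t" using rs r0 by (simp add: t_def)
  have T: "1 < T" using F_mono[OF r s rs(1)] Fr by (simp add: T_def)
  have "s = t * r" "F s = T * F r" using r0 Fr by (auto simp: t_def T_def)
  then have "r ^ 3 * (t ^ 3 + 2 * c - 3 * t) = 0" "F r ^ 3 * (T ^ 3 + 2 * c - 3 * T) = 0"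
    using c P0 unfolding P_def by (simp_all add: algebra_simps power2_eq_square power3_eq_cube)
  then have "t ^ 3 + 2 * c - 3 * t = 0" "T ^ 3 + 2 * c - 3 * T = 0" using r0 Fr by auto
  moreover have "(t - T) * (t\<^sup>2 + t * T + T\<^sup>2 - 3) =
    (t ^ 3 + 2 * c - 3 * t) - (T ^ 3 + 2 * c - 3 * T)"
    by (simp add: algebra_simps power2_eq_square power3_eq_cube)
  ultimately have "(t - T) * (t\<^sup>2 + t * T + T\<^sup>2 - 3) = 0" by simp
  moreover have "1 < t\<^sup>2" "1 < t * T" "1 < T\<^sup>2" using t T by (auto intro: less_1_mult)
  ultimately have "t = T" by auto
  then show ?thesis using r0 Fr by (simp add: t_def T_def field_simps)
qed

text \<open>Because of the bound 2 on the quotient, \<open>F_ratio\<close> is a local statement.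
  Proportionality is an equivalence relation on \<open>J\<close>, so connectedness spreads it.
  Within (x / 2, 2 x) the quotient of the larger by the smaller of \<open>x\<close> and
  \<open>y\<close> is below 2.\<close>

lemma F_linear: "\<exists>\<alpha>>0. \<forall>r\<in>J. F r = \<alpha> * r"
proof -
  have conn: "connected J" using J_interval by (simp add: is_interval_connected)
  have lin: "F a * b = F b * a" if "a \<in> J" "b \<in> J" for a b
  proof (rule connected_equivalence_relation[OF conn that])
    fix x y assume "F x * y = F y * x" then show "F y * x = F x * y" by simp
  next
    fix x y z assume *: "F x * y = F y * x" "F y * z = F z * y" "y \<in> J"
    have "y * (F x * z) = F x * y * z" by simp
    also have "\<dots> = x * (F y * z)" by (simp add: *(1))
    also have "\<dots> = y * (F z * x)" by (simp add: *(2))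
    finally have "y * (F x * z) = y * (F z * x)" .
    then show "F x * z = F z * x" using * J_pos by auto
  next
    fix x assume x: "x \<in> J"
    then have x0: "0 < x" using J_pos by auto
    show "\<exists>T. openin (top_of_set J) T \<and> x \<in> T \<and> (\<forall>y\<in>T. F x * y = F y * x)"
    proof (intro exI[of _ "J \<inter> {x / 2<..<2 * x}"] conjI ballI)
      show "openin (top_of_set J) (J \<inter> {x / 2<..<2 * x})" by (rule openin_open_Int) simp
      show "x \<in> J \<inter> {x / 2<..<2 * x}" using x x0 by simp
      fix y assume "y \<in> J \<inter> {x / 2<..<2 * x}"
      then show "F x * y = F y * x"
        using F_ratio[OF x, of y] F_ratio[OF _ x, of y] by (cases x y rule: linorder_cases) auto
    qed
  qed
  have b0: "0 < base" using base J_pos by auto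
  show ?thesis
  proof (intro exI[of _ "F base / base"] conjI ballI)
    show "0 < F base / base" using F_pos[OF base(1)] b0 by simp
    fix r assume "r \<in> J"
    then show "F r = F base / base * r" using lin[OF base(1), of r] b0 by (simp add: field_simps)
  qed
qed

lemma f_linear:
  "\<exists>\<alpha>>0. (\<forall>z. cmod z \<in> J \<longrightarrow> f z = of_real \<alpha> * z) \<or> (\<forall>z. cmod z \<in> J \<longrightarrow> f z = of_real \<alpha> * cnj z)"
proof -
  obtain \<alpha> where \<alpha>: "\<alpha> > 0" "\<And>r. r \<in> J \<Longrightarrow> F r = \<alpha> * r" using F_linear by blast
  have polar: "f z = of_real \<alpha> * of_real (cmod z) * phase (sgn z)" "cmod (sgn z) = 1"
    if "cmod z \<in> J" for z
  proof -
    have "z \<noteq> 0" using that J_pos by auto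
    then show n: "cmod (sgn z) = 1" by (simp add: norm_sgn)
    have "of_real (cmod z) * sgn z = z" by (simp add: sgn_eq)
    then show "f z = of_real \<alpha> * of_real (cmod z) * phase (sgn z)"
      using f_polar[OF that n] \<alpha>(2)[OF that] by simp
  qed
  have *: "of_real (cmod z) * sgn z = z" "of_real (cmod z) * cnj (sgn z) = cnj z" for z
    by (auto simp: sgn_eq)
  show ?thesis
    using phase_cases
  proof
    assume "\<forall>u. cmod u = 1 \<longrightarrow> phase u = u"
    then show ?thesis using polar * \<alpha>(1) by (intro exI[of _ \<alpha>]) (simp add: mult.assoc)
  next
    assume "\<forall>u. cmod u = 1 \<longrightarrow> phase u = cnj u"
    then show ?thesis using polar * \<alpha>(1) by (intro exI[of _ \<alpha>]) (simp add: mult.assoc)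
  qed
qed

end

subsection \<open>Linear and conjugate-linear maps\<close>

lemma pd_scale_iff:
  assumes "0 < \<alpha>"
  shows "pd n (\<lambda>i j. of_real \<alpha> * B i j) \<longleftrightarrow> pd n B"
proof -
  have h: "hform n (\<lambda>i j. of_real \<alpha> * B i j) x = of_real \<alpha> * hform n B x" for x
    by (simp add: hform_def sum_distrib_left mult.assoc)
  have "herm n (\<lambda>i j. of_real \<alpha> * B i j) \<longleftrightarrow> herm n B"
    using assms by (simp add: herm_def)
  moreover have "0 < of_real \<alpha> * z \<longleftrightarrow> 0 < z" for z :: complex
    using assms by (auto simp: less_complex_def zero_less_mult_iff)
  ultimately show ?thesis unfolding pd_def h by simp
qed

lemma psd_scale_iff:
  assumes "0 < \<alpha>"
  shows "psd n (\<lambda>i j. of_real \<alpha> * B i j) \<longleftrightarrow> psd n B"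
proof -
  have h: "hform n (\<lambda>i j. of_real \<alpha> * B i j) x = of_real \<alpha> * hform n B x" for x
    by (simp add: hform_def sum_distrib_left mult.assoc)
  have "herm n (\<lambda>i j. of_real \<alpha> * B i j) \<longleftrightarrow> herm n B"
    using assms by (simp add: herm_def)
  moreover have "0 \<le> of_real \<alpha> * z \<longleftrightarrow> 0 \<le> z" for z :: complex
    using assms by (auto simp: less_eq_complex_def zero_le_mult_iff)
  ultimately show ?thesis unfolding psd_def h by simp
qed

lemma hform_cnj: "hform n (\<lambda>i j. cnj (B i j)) x = cnj (hform n B (\<lambda>i. cnj (x i)))"
  by (simp add: hform_def)

lemma herm_cnj_iff: "herm n (\<lambda>i j. cnj (B i j)) \<longleftrightarrow> herm n B"
  unfolding herm_def by (metis complex_cnj_cnj)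

text \<open>Conjugating the entries conjugates the value of the form at the conjugate vector, and
  positive complex numbers are real.\<close>

lemma pd_cnj_iff: "pd n (\<lambda>i j. cnj (B i j)) \<longleftrightarrow> pd n B"
proof -
  have imp: "pd n (\<lambda>i j. cnj (B i j))" if "pd n B" for B
    unfolding pd_def hform_cnj herm_cnj_iff
  proof (intro conjI allI impI)
    fix x :: "nat \<Rightarrow> complex" assume "\<exists>i<n. x i \<noteq> 0"
    then obtain i where "i < n" "x i \<noteq> 0" by blast
    then have "0 < hform n B (\<lambda>i. cnj (x i))" by (intro pdD[OF that, of i]) auto
    then show "0 < cnj (hform n B (\<lambda>i. cnj (x i)))" by (simp add: less_complex_def)
  qed (use that in \<open>simp add: pd_def\<close>)
  show ?thesis using imp[of B] imp[of "\<lambda>i j. cnj (B i j)"] by auto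
qed

lemma psd_cnj_iff: "psd n (\<lambda>i j. cnj (B i j)) \<longleftrightarrow> psd n B"
proof -
  have imp: "psd n (\<lambda>i j. cnj (B i j))" if "psd n B" for B
    using that unfolding psd_def hform_cnj herm_cnj_iff by (simp add: less_eq_complex_def)
  show ?thesis using imp[of B] imp[of "\<lambda>i j. cnj (B i j)"] by auto
qed

lemma linear_or_conjugate_preserves:
  assumes A: "A \<in> mats_over n \<Omega>" and \<alpha>: "0 < \<alpha>"
    and f: "(\<forall>z\<in>\<Omega>. f z = of_real \<alpha> * z) \<or> (\<forall>z\<in>\<Omega>. f z = of_real \<alpha> * cnj z)"
  shows "pos_def A \<longleftrightarrow> pos_def (map_mat f A)" and "pos_semidef A \<longleftrightarrow> pos_semidef (map_mat f A)"
proof -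
  have c: "A \<in> carrier_mat n n" "map_mat f A \<in> carrier_mat n n"
    using A by (auto simp: mats_over_def)
  have entry: "A $$ (i, j) \<in> \<Omega>" "map_mat f A $$ (i, j) = f (A $$ (i, j))" if "i < n" "j < n" for i j
    using elements_matI[OF c(1) that refl] A that c(1) by (auto simp: mats_over_def)
  have "(pd n (\<lambda>i j. map_mat f A $$ (i, j)) \<longleftrightarrow> pd n (\<lambda>i j. A $$ (i, j))) \<and>
        (psd n (\<lambda>i j. map_mat f A $$ (i, j)) \<longleftrightarrow> psd n (\<lambda>i j. A $$ (i, j)))"
    using f
  proof
    assume f: "\<forall>z\<in>\<Omega>. f z = of_real \<alpha> * z"
    then have eq: "map_mat f A $$ (i, j) = of_real \<alpha> * A $$ (i, j)" if "i < n" "j < n" for i j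
      using entry[OF that] by simp
    have "pd n (\<lambda>i j. map_mat f A $$ (i, j)) \<longleftrightarrow> pd n (\<lambda>i j. of_real \<alpha> * A $$ (i, j))"
      "psd n (\<lambda>i j. map_mat f A $$ (i, j)) \<longleftrightarrow> psd n (\<lambda>i j. of_real \<alpha> * A $$ (i, j))"
      by (rule pd_cong psd_cong, erule (1) eq)+
    then show ?thesis by (simp add: pd_scale_iff psd_scale_iff \<alpha>)
  next
    assume f: "\<forall>z\<in>\<Omega>. f z = of_real \<alpha> * cnj z"
    then have eq: "map_mat f A $$ (i, j) = of_real \<alpha> * cnj (A $$ (i, j))" if "i < n" "j < n" for i j
      using entry[OF that] by simp
    have "pd n (\<lambda>i j. map_mat f A $$ (i, j)) \<longleftrightarrow> pd n (\<lambda>i j. of_real \<alpha> * cnj (A $$ (i, j)))"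
      "psd n (\<lambda>i j. map_mat f A $$ (i, j)) \<longleftrightarrow> psd n (\<lambda>i j. of_real \<alpha> * cnj (A $$ (i, j)))"
      by (rule pd_cong psd_cong, erule (1) eq)+
    then show ?thesis
      by (simp add: pd_scale_iff psd_scale_iff \<alpha> pd_cnj_iff psd_cnj_iff)
  qed
  then show "pos_def A \<longleftrightarrow> pos_def (map_mat f A)" "pos_semidef A \<longleftrightarrow> pos_semidef (map_mat f A)"
    by (simp_all add: pos_def_iff_pd[OF c(1)] pos_def_iff_pd[OF c(2)] pos_semidef_iff_psd[OF c(1)] pos_semidef_iff_psd[OF c(2)])
qed

section \<open>Applying f to entries of small matrices\<close>

lemma mat_of_fun_in_mats_over:
  assumes "herm n B" "\<And>i j. i < n \<Longrightarrow> j < n \<Longrightarrow> B i j \<in> \<Omega>"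
  defines "A \<equiv> Matrix.mat n n (\<lambda>(i, j). B i j)"
  shows "A \<in> mats_over n \<Omega>" "hermitian A"
    "pos_def A \<longleftrightarrow> pd n B" "pos_def (map_mat f A) \<longleftrightarrow> pd n (\<lambda>i j. f (B i j))"
    "pos_semidef A \<longleftrightarrow> psd n B" "pos_semidef (map_mat f A) \<longleftrightarrow> psd n (\<lambda>i j. f (B i j))"
proof -
  have c: "A \<in> carrier_mat n n" "map_mat f A \<in> carrier_mat n n" by (auto simp: A_def)
  have e: "A $$ (i, j) = B i j" "map_mat f A $$ (i, j) = f (B i j)" if "i < n" "j < n" for i j
    using that by (auto simp: A_def)
  show "A \<in> mats_over n \<Omega>" using assms(2) by (auto simp: mats_over_def elements_mat_def A_def)
  show "hermitian A" unfolding hermitian_iff_herm[OF c(1)]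
    by (rule herm_cong[THEN iffD2, OF _ assms(1)]) (rule e(1))
  show "pos_def A \<longleftrightarrow> pd n B" unfolding pos_def_iff_pd[OF c(1)] by (rule pd_cong) (rule e(1))
  show "pos_def (map_mat f A) \<longleftrightarrow> pd n (\<lambda>i j. f (B i j))"
    unfolding pos_def_iff_pd[OF c(2)] by (rule pd_cong) (rule e(2))
  show "pos_semidef A \<longleftrightarrow> psd n B" unfolding pos_semidef_iff_psd[OF c(1)] by (rule psd_cong) (rule e(1))
  show "pos_semidef (map_mat f A) \<longleftrightarrow> psd n (\<lambda>i j. f (B i j))"
    unfolding pos_semidef_iff_psd[OF c(2)] by (rule psd_cong) (rule e(2))
qed

text \<open>Repetition commutes with every entrywise map, whereas bordering by zeros would require
  that 0 be fixed.\<close>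

lemma map_pad: "(\<lambda>i j. f (pad k B D i j)) = pad k (\<lambda>i j. f (B i j)) (f D)"
  by (auto simp: pad_def fun_eq_iff)

lemma map_mat2:
  assumes "f (cnj w) = cnj (f w)"
  shows "(\<lambda>i j. f (mat2 a b w i j)) = mat2 (f a) (f b) (f w)"
  using assms by (auto simp: mat2_def fun_eq_iff)

lemma map_mat3:
  assumes "f (cnj u) = cnj (f u)" "f (cnj v) = cnj (f v)" "f (cnj w) = cnj (f w)"
  shows "(\<lambda>i j. f (mat3 a u v w i j)) = mat3 (f a) (f u) (f v) (f w)"
  using assms by (auto simp: mat3_def fun_eq_iff Let_def)

text \<open>The equality case of Re z <= |z|, which turns a one-sided determinant estimate into an
  exact phase.\<close>

lemma complex_eq_of_real_if_Re_ge:
  assumes "cmod z = c" "c \<le> Re z"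
  shows "z = of_real c"
proof -
  have "Re z = c" using complex_Re_le_cmod[of z] assms by linarith
  moreover from this have "Im z = 0" using cmod_power2[of z] assms by simp
  ultimately show ?thesis by (simp add: complex_eq_iff)
qed

lemma det3_phase:
  assumes "cmod u = 1"
  shows "det3 a (of_real r * u) (of_real r) (of_real r) = a ^ 3 + 2 * r ^ 3 * Re u - 3 * a * r\<^sup>2"
  using assms by (simp add: det3_def norm_mult power2_eq_square power3_eq_cube)

text \<open>The three phases cancel in the cyclic product of the entries, so the determinant is that
  of the real matrix with off-diagonal entries r, s, r. It vanishes at a = s because two of its rows
  then agree up to the phases.\<close>

lemma det3_product:
  assumes "cmod u = 1" "cmod w = 1"
  shows "det3 a (of_real r * u) (of_real s * (u * w)) (of_real r * w) = (a - s) * (a\<^sup>2 + a * s - 2 * r\<^sup>2)"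
proof -
  have "of_real r * u * (of_real r * w) * cnj (of_real s * (u * w)) =
    of_real (r\<^sup>2 * s) * ((u * cnj u) * (w * cnj w))"
    by (simp add: power2_eq_square mult_ac)
  also have "\<dots> = of_real (r\<^sup>2 * s)"
    using assms complex_norm_square[of u] complex_norm_square[of w] by simp
  finally have "Re (of_real r * u * (of_real r * w) * cnj (of_real s * (u * w))) = r\<^sup>2 * s"
    by (metis Re_complex_of_real)
  then show ?thesis
    using assms unfolding det3_def by (simp add: norm_mult algebra_simps power2_eq_square power3_eq_cube)
qed

subsection \<open>Maps on an annulus\<close>

locale radial_domain =
  fixes n :: nat and I :: "real set" and f :: "complex \<Rightarrow> complex"
  assumes n3: "3 \<le> n" and interval: "is_interval I" and nonneg: "I \<subseteq> {0..}"
begin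

definition J :: "real set" where "J = I \<inter> {0<..}"
definition F :: "real \<Rightarrow> real" where "F r = Re (f (of_real r))"

lemma J_I: "r \<in> J \<Longrightarrow> r \<in> I" "r \<in> J \<Longrightarrow> 0 < r" "r \<in> I \<Longrightarrow> 0 < r \<Longrightarrow> r \<in> J"
  by (auto simp: J_def)

lemma interval_J: "is_interval J" "J \<subseteq> {0<..}"
  unfolding J_def using interval by (auto intro: is_interval_Int)

text \<open>The centre carries no phase and is treated by a limit: if 0 is a radius,
  \<open>J\<close> contains arbitrarily small radii y, and |f 0| <= F y = \<alpha> y forces f 0 =
  0.\<close>

lemma linear_on_annulus:
  assumes "radial_transfer J F f" and zero: "\<And>y. 0 \<in> I \<Longrightarrow> y \<in> J \<Longrightarrow> cmod (f 0) \<le> F y"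
  shows "\<exists>\<alpha>>0. (\<forall>z\<in>annulus I. f z = of_real \<alpha> * z) \<or> (\<forall>z\<in>annulus I. f z = of_real \<alpha> * cnj z)"
proof -
  interpret radial_transfer J F f by fact
  obtain \<alpha> where \<alpha>: "\<alpha> > 0"
    "(\<forall>z. cmod z \<in> J \<longrightarrow> f z = of_real \<alpha> * z) \<or> (\<forall>z. cmod z \<in> J \<longrightarrow> f z = of_real \<alpha> * cnj z)"
    using f_linear by blast
  have F_eq: "F y = \<alpha> * y" if "y \<in> J" for y
    using \<alpha>(2) that J_I(2)[OF that] by (auto simp: F_def)
  have f0: "f 0 = 0" if "0 \<in> I"
  proof -
    obtain s where s: "s \<in> J" using nontrivial by blast
    have "cmod (f 0) \<le> \<alpha> * s * e" if "0 < e" "e < 1" for e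
    proof -
      have "s * e \<in> I"
        using interval \<open>0 \<in> I\<close> J_I(1,2)[OF s] that mem_is_interval_1_I[of I 0 s "s * e"] by simp
      then have "s * e \<in> J" using J_I s that by simp
      then show ?thesis using zero[OF \<open>0 \<in> I\<close>] F_eq by (simp add: mult.assoc)
    qed
    then have "\<forall>\<^sub>F e in at_right 0. cmod (f 0) \<le> \<alpha> * s * e"
      unfolding eventually_at_right_field by (intro exI[of _ 1]) auto
    moreover have "((\<lambda>e. \<alpha> * s * e) \<longlongrightarrow> \<alpha> * s * 0) (at_right 0)" by (intro tendsto_intros)
    ultimately have "cmod (f 0) \<le> \<alpha> * s * 0" using tendsto_lowerbound trivial_limit_at_right_real by blast
    then show ?thesis by simp
  qed
  have cases: "z = 0 \<and> 0 \<in> I \<or> cmod z \<in> J" if "z \<in> annulus I" for z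
    using that by (auto simp: annulus_def J_def)
  show ?thesis
    using \<alpha>(2)
  proof
    assume "\<forall>z. cmod z \<in> J \<longrightarrow> f z = of_real \<alpha> * z"
    then have "\<forall>z\<in>annulus I. f z = of_real \<alpha> * z" using cases f0 by (metis mult_zero_right)
    then show ?thesis using \<alpha>(1) by blast
  next
    assume "\<forall>z. cmod z \<in> J \<longrightarrow> f z = of_real \<alpha> * cnj z"
    then have "\<forall>z\<in>annulus I. f z = of_real \<alpha> * cnj z" using cases f0 by (metis mult_zero_right complex_cnj_zero)
    then show ?thesis using \<alpha>(1) by blast
  qed
qed

lemma mat2_in_annulus:
  assumes "a \<in> I" "b \<in> I" "cmod w \<in> I"
  shows "cmod (mat2 (of_real a) (of_real b) w i j) \<in> I"
proof -
  have "\<bar>a\<bar> = a" "\<bar>b\<bar> = b" using assms nonneg by auto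
  then show ?thesis using assms by (simp add: mat2_def)
qed

lemma mat3_in_annulus:
  assumes "a \<in> I" "cmod u \<in> I" "cmod v \<in> I" "cmod w \<in> I"
  shows "cmod (mat3 (of_real a) u v w i j) \<in> I"
proof -
  have "\<bar>a\<bar> = a" using assms nonneg by auto
  then show ?thesis using assms by (simp add: mat3_def Let_def)
qed

lemma pad_in_annulus:
  assumes "1 \<le> k" "\<And>i j. i < k \<Longrightarrow> j < k \<Longrightarrow> cmod (B i j) \<in> I" "cmod D \<in> I"
  shows "cmod (pad k B D i j) \<in> I"
  using assms by (simp add: pad_def)

end

subsection \<open>The positive definite case\<close>

locale pd_preserver = radial_domain +
  assumes preserves: "\<And>A. A \<in> mats_over n (annulus I) \<Longrightarrow> hermitian A \<Longrightarrow> pos_def A \<longleftrightarrow> pos_def (map_mat f A)"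
    and no_max: "\<And>r. r \<in> I \<Longrightarrow> \<exists>s\<in>I. r < s"
    and nonempty: "I \<noteq> {}"
begin

lemma preserves_pd:
  assumes "herm n B" "\<And>i j. i < n \<Longrightarrow> j < n \<Longrightarrow> cmod (B i j) \<in> I"
  shows "pd n B \<longleftrightarrow> pd n (\<lambda>i j. f (B i j))"
proof -
  have "B i j \<in> annulus I" if "i < n" "j < n" for i j using assms(2)[OF that] by (simp add: annulus_def)
  note m = mat_of_fun_in_mats_over[where \<Omega> = "annulus I", OF assms(1) this]
  show ?thesis using preserves[OF m(1,2)] m(3) m(4)[of f] by simp
qed

text \<open>The raised diagonal entry is a larger radius supplied by \<open>no_max\<close>. This
  direction rests on preservation alone, so it can be used to obtain the monotonicity of
  \<open>F\<close> that \<open>backward\<close> needs.\<close>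

lemma forward:
  assumes k: "1 \<le> k" "k \<le> 3" and B: "\<And>i j. i < k \<Longrightarrow> j < k \<Longrightarrow> cmod (B i j) \<in> I" and pd: "pd k B"
  shows "pd k (\<lambda>i j. f (B i j))"
proof -
  let ?b = "B (k - 1) (k - 1)"
  have kn: "k \<le> n" using k n3 by simp
  have h: "herm k B" using pd by (simp add: pd_def)
  obtain s where s: "s \<in> I" "cmod ?b < s" using no_max[of "cmod ?b"] B[of "k - 1" "k - 1"] k by auto
  have s0: "0 \<le> s" using s nonneg by auto
  have "cnj ?b = ?b" using hermD[OF h, of "k - 1" "k - 1"] k by simp
  then have "Im ?b = 0" by (simp add: complex_eq_iff)
  then have "?b < of_real s" using s complex_Re_le_cmod[of ?b] by (simp add: less_complex_def)
  then have "pd n (pad k B (of_real s))" by (intro pd_pad k kn pd) auto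
  moreover have "herm n (pad k B (of_real s))" by (intro herm_pad k kn h) auto
  moreover have "cmod (pad k B (of_real s) i j) \<in> I" for i j
    by (intro pad_in_annulus k B) (use s s0 in auto)
  ultimately have "pd n (\<lambda>i j. f (pad k B (of_real s) i j))" using preserves_pd by blast
  then show ?thesis unfolding map_pad by (rule pd_of_pd_pad[OF k(1) kn])
qed

text \<open>Positive definiteness of the image includes being Hermitian; a diagonal above |w| gives
  a positive definite matrix with entry \<open>w\<close>.\<close>

lemma f_cnj:
  assumes w: "cmod w \<in> I"
  shows "f (cnj w) = cnj (f w)"
proof -
  obtain y where y: "y \<in> I" "cmod w < y" using no_max w by blast
  have y0: "0 < y" using y norm_ge_zero[of w] by linarith
  have "pd 2 (mat2 (of_real y) (of_real y) w)"
    unfolding pd_mat2_iff[OF y0] using y by (simp add: power_strict_mono flip: power2_eq_square)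
  then have "pd 2 (\<lambda>i j. f (mat2 (of_real y) (of_real y) w i j))"
    by (rule forward[rotated 3]) (use mat2_in_annulus y w in auto)
  then have "herm 2 (\<lambda>i j. f (mat2 (of_real y) (of_real y) w i j))" by (simp add: pd_def)
  from hermD[OF this, of 0 1] show ?thesis by (simp add: mat2_def)
qed

lemma f_of_real:
  assumes "r \<in> I"
  shows "f (of_real r) = of_real (F r)"
proof -
  have "cmod (of_real r) \<in> I" using assms nonneg by auto
  from f_cnj[OF this] show ?thesis by (simp add: F_def complex_eq_iff)
qed

text \<open>The matrix with diagonal r, s and off-diagonal entry r has determinant r (s - r) > 0;
  its image gives F(r)^2 < F(r) F(s).\<close>

lemma F_pos_mono:
  assumes "r \<in> J" "s \<in> J" "r < s"
  shows "0 < F r" "F r < F s"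
proof -
  have r: "r \<in> I" "s \<in> I" "0 < r" using assms J_I by auto
  have "pd 2 (mat2 (of_real r) (of_real s) (of_real r))"
    unfolding pd_mat2_iff[OF r(3)] using r assms by (simp add: power2_eq_square)
  then have "pd 2 (\<lambda>i j. f (mat2 (of_real r) (of_real s) (of_real r) i j))"
    by (rule forward[rotated 3]) (use mat2_in_annulus r in auto)
  then have *: "pd 2 (mat2 (of_real (F r)) (of_real (F s)) (of_real (F r)))"
    using map_mat2[of f "of_real r"] f_of_real r by simp
  then show Fr: "0 < F r" using pos_of_pd_mat2 by (fastforce simp: less_complex_def)
  show "F r < F s" using * unfolding pd_mat2_iff[OF Fr] using Fr by (simp add: power2_eq_square)
qed

lemma F_pos: "r \<in> J \<Longrightarrow> 0 < F r"
  using F_pos_mono(1) no_max J_I by (meson less_trans)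

text \<open>Now the padded matrix must be definite after applying \<open>f\<close>, so the raised
  entry has to satisfy F(b) < F(s). Hence the last diagonal entry is taken in \<open>J\<close>,
  where \<open>F\<close> is known to increase strictly.\<close>

lemma backward:
  assumes k: "1 \<le> k" "k \<le> 3" and B: "\<And>i j. i < k \<Longrightarrow> j < k \<Longrightarrow> cmod (B i j) \<in> I" and h: "herm k B"
    and b: "B (k - 1) (k - 1) = of_real b" "b \<in> J" and pd: "pd k (\<lambda>i j. f (B i j))"
  shows "pd k B"
proof -
  have kn: "k \<le> n" using k n3 by simp
  obtain s where s: "s \<in> I" "b < s" using no_max J_I b by blast
  then have sJ: "s \<in> J" using b J_I by (meson less_trans)
  have s0: "0 < s" using sJ J_I by blast
  have "f (B (k - 1) (k - 1)) < f (of_real s)"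
    using b f_of_real s J_I F_pos_mono(2)[OF b(2) sJ s(2)] by (simp add: less_complex_def)
  then have "pd n (pad k (\<lambda>i j. f (B i j)) (f (of_real s)))"
    by (intro pd_pad k kn pd) (simp_all add: f_of_real[OF s(1)])
  moreover have "herm n (pad k B (of_real s))" by (intro herm_pad k kn h) auto
  moreover have "cmod (pad k B (of_real s) i j) \<in> I" for i j
    by (intro pad_in_annulus k B) (use s s0 in auto)
  ultimately have "pd n (pad k B (of_real s))"
    using preserves_pd[of "pad k B (of_real s)"] by (simp add: map_pad)
  then show ?thesis by (rule pd_of_pd_pad[OF k(1) kn])
qed

lemma mat2_transfer:
  assumes "x \<in> J" "z \<in> J" "cmod w \<in> I"
  shows "(cmod w)\<^sup>2 < x * z \<longleftrightarrow> (cmod (f w))\<^sup>2 < F x * F z"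
proof -
  let ?B = "mat2 (of_real x) (of_real z) w"
  have I: "x \<in> I" "z \<in> I" "0 < x" using assms J_I by auto
  have B: "cmod (?B i j) \<in> I" for i j by (rule mat2_in_annulus) (use I assms in auto)
  have "pd 2 ?B \<longleftrightarrow> pd 2 (\<lambda>i j. f (?B i j))"
    using forward[of 2 ?B] backward[of 2 ?B z] B herm_mat2 assms(2) by (auto simp: mat2_def)
  also have "(\<lambda>i j. f (?B i j)) = mat2 (of_real (F x)) (of_real (F z)) (f w)"
    using map_mat2[OF f_cnj[OF assms(3)]] f_of_real I by simp
  finally show ?thesis unfolding pd_mat2_iff[OF I(3)] pd_mat2_iff[OF F_pos[OF assms(1)]] .
qed

lemma f_less:
  assumes "y \<in> J" "cmod w \<in> I" "cmod w < y"
  shows "cmod (f w) < F y"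
proof -
  have "(cmod w)\<^sup>2 < y * y" using assms by (simp add: power_strict_mono flip: power2_eq_square)
  then have "(cmod (f w))\<^sup>2 < (F y)\<^sup>2" using mat2_transfer[OF assms(1,1,2)] by (simp add: power2_eq_square)
  then show ?thesis using F_pos[OF assms(1)] by (simp add: power2_less_imp_less)
qed

lemma mat3_transfer:
  assumes "a \<in> J" "cmod u \<in> I" "cmod v \<in> I" "cmod w \<in> I" "cmod u < a"
  shows "0 < det3 a u v w \<longleftrightarrow> 0 < det3 (F a) (f u) (f v) (f w)"
proof -
  let ?B = "mat3 (of_real a) u v w"
  have I: "a \<in> I" "0 < a" using assms J_I by auto
  have B: "cmod (?B i j) \<in> I" for i j by (rule mat3_in_annulus) (use I assms in auto)
  have "pd 3 ?B \<longleftrightarrow> pd 3 (\<lambda>i j. f (?B i j))"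
    using forward[of 3 ?B] backward[of 3 ?B a] B herm_mat3 assms(1) by (auto simp: mat3_def)
  also have "(\<lambda>i j. f (?B i j)) = mat3 (of_real (F a)) (f u) (f v) (f w)"
    using map_mat3[of f u v w] f_cnj assms f_of_real I by simp
  finally show ?thesis
    unfolding pd_mat3_iff[OF I(2) assms(5)] pd_mat3_iff[OF F_pos[OF assms(1)] f_less[OF assms(1,2,5)]] .
qed

lemma F_right:
  assumes "r \<in> J" "s \<in> J" "r < s"
  shows "(F \<longlongrightarrow> F r) (at_right r)"
proof (rule right_continuous_of_log_midconvex[where F = F, OF interval_J F_pos F_pos_mono(2) _ assms])
  fix x y z assume xyz: "x \<in> J" "y \<in> J" "z \<in> J" "y\<^sup>2 < x * z"
  then have "y \<in> I" "0 < y" using J_I by auto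
  then have "(cmod (f (of_real y)))\<^sup>2 < F x * F z"
    using mat2_transfer[OF xyz(1,3), of "of_real y"] xyz(4) by simp
  then show "(F y)\<^sup>2 \<le> F x * F z" using f_of_real[OF \<open>y \<in> I\<close>] by simp
qed

lemma right_neighbour:
  assumes "r \<in> J"
  shows "\<exists>s\<in>J. r < s"
  using no_max J_I assms by (meson less_trans)

text \<open>The upper bound is a limit of \<open>f_less\<close> over radii decreasing to |w|. The
  lower bound comes from the matrix with diagonal |w| and entry \<open>w\<close>: it is singular, so
  neither it nor its image is definite.\<close>

lemma f_norm:
  assumes "cmod w \<in> J"
  shows "cmod (f w) = F (cmod w)"
proof (rule antisym)
  obtain s where s: "s \<in> J" "cmod w < s" using right_neighbour assms by blast
  have "\<forall>\<^sub>F y in at_right (cmod w). cmod (f w) \<le> F y"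
    unfolding eventually_at_right_field
  proof (intro exI[of _ s] conjI allI impI s)
    fix y assume y: "cmod w < y" "y < s"
    have "y \<in> J" using interval_J(1) assms s(1) y mem_is_interval_1_I less_imp_le by blast
    then show "cmod (f w) \<le> F y" using f_less[of y w] y assms J_I by (simp add: less_imp_le)
  qed
  then show "cmod (f w) \<le> F (cmod w)"
    by (rule tendsto_lowerbound[OF F_right[OF assms s]]) simp
  have "\<not> (cmod (f w))\<^sup>2 < F (cmod w) * F (cmod w)"
    using mat2_transfer[OF assms assms, of w] assms J_I by (simp add: power2_eq_square)
  then show "F (cmod w) \<le> cmod (f w)"
    by (metis F_pos[OF assms] linorder_not_less norm_ge_zero power2_eq_square power_strict_mono zero_less_numeral)
qed

text \<open>The matrix of \<open>det3_product\<close> is singular at diagonal \<open>s\<close>, so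
  definiteness is transferred for diagonals \<open>a\<close> above \<open>s\<close> and
  \<open>a\<close> then decreases to \<open>s\<close>. In the limit the cubes of \<open>F s\<close>
  cancel, and the real part of the product is bounded below by its modulus.\<close>

lemma f_mult:
  assumes r: "r \<in> J" and s: "s \<in> J" and rs: "r < s" and u: "cmod u = 1" and w: "cmod w = 1"
  shows "f (of_real r * u) * f (of_real r * w) * cnj (f (of_real s * (u * w))) = of_real ((F r)\<^sup>2 * F s)"
    (is "?X = _")
proof (rule complex_eq_of_real_if_Re_ge)
  have rs0: "0 < r" "0 < s" using r s J_I by auto
  have n: "cmod (of_real r * u) = r" "cmod (of_real r * w) = r" "cmod (of_real s * (u * w)) = s"
    using u w rs0 by (auto simp: norm_mult)
  have fn: "cmod (f (of_real r * u)) = F r" "cmod (f (of_real r * w)) = F r" "cmod (f (of_real s * (u * w))) = F s"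
    using f_norm n r s by metis+
  then show "cmod ?X = (F r)\<^sup>2 * F s" by (simp add: norm_mult power2_eq_square)
  obtain b where b: "b \<in> J" "s < b" using right_neighbour s by blast
  have "0 \<le> F a ^ 3 + 2 * Re ?X - F a * (2 * (F r)\<^sup>2 + (F s)\<^sup>2)" if a: "s < a" "a < b" for a
  proof -
    have aJ: "a \<in> J" using interval_J(1) s b(1) a mem_is_interval_1_I less_imp_le by blast
    have "r * r < a * s" using rs a rs0 by (intro mult_strict_mono) auto
    moreover have "r * r < a * a" using rs a rs0 by (intro mult_strict_mono) auto
    ultimately have "0 < (a - s) * (a\<^sup>2 + a * s - 2 * r\<^sup>2)"
      using a by (intro mult_pos_pos) (auto simp: power2_eq_square)
    then have "0 < det3 a (of_real r * u) (of_real s * (u * w)) (of_real r * w)"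
      by (simp add: det3_product[OF u w])
    then have "0 < det3 (F a) (f (of_real r * u)) (f (of_real s * (u * w))) (f (of_real r * w))"
      by (subst (asm) mat3_transfer) (use aJ n r s J_I rs a in auto)
    then show ?thesis unfolding det3_def fn by (simp add: algebra_simps)
  qed
  then have "\<forall>\<^sub>F a in at_right s. 0 \<le> F a ^ 3 + 2 * Re ?X - F a * (2 * (F r)\<^sup>2 + (F s)\<^sup>2)"
    unfolding eventually_at_right_field using b(2) by blast
  moreover have "((\<lambda>a. F a ^ 3 + 2 * Re ?X - F a * (2 * (F r)\<^sup>2 + (F s)\<^sup>2)) \<longlongrightarrow>
      F s ^ 3 + 2 * Re ?X - F s * (2 * (F r)\<^sup>2 + (F s)\<^sup>2)) (at_right s)"
    by (intro tendsto_intros F_right[OF s b])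
  ultimately have "0 \<le> F s ^ 3 + 2 * Re ?X - F s * (2 * (F r)\<^sup>2 + (F s)\<^sup>2)"
    using tendsto_lowerbound trivial_limit_at_right_real by blast
  then show "(F r)\<^sup>2 * F s \<le> Re ?X" by (simp add: algebra_simps power2_eq_square power3_eq_cube)
qed

lemma det_transfer:
  assumes r: "r \<in> J" and s: "s \<in> J" and rs: "r < s" and u: "cmod u = 1"
  shows "0 < s ^ 3 + 2 * r ^ 3 * Re u - 3 * s * r\<^sup>2 \<longleftrightarrow>
    0 < F s ^ 3 + 2 * (F r)\<^sup>2 * Re (f (of_real r * u)) - 3 * F s * (F r)\<^sup>2"
proof -
  have r0: "0 < r" "r \<in> I" using r J_I by auto
  have n: "cmod (of_real r * u) = r" using u r0 by (simp add: norm_mult)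
  have fn: "cmod (f (of_real r * u)) = F r" using f_norm n r by metis
  have "0 < det3 s (of_real r * u) (of_real r) (of_real r) \<longleftrightarrow>
    0 < det3 (F s) (f (of_real r * u)) (f (of_real r)) (f (of_real r))"
    by (rule mat3_transfer) (use s n r0 rs in auto)
  then show ?thesis
    unfolding det3_phase[OF u] f_of_real[OF r0(2)] unfolding det3_def fn
    by (simp add: algebra_simps power2_eq_square)
qed

lemma linear:
  "\<exists>\<alpha>>0. (\<forall>z\<in>annulus I. f z = of_real \<alpha> * z) \<or> (\<forall>z\<in>annulus I. f z = of_real \<alpha> * cnj z)"
proof (rule linear_on_annulus)
  show "radial_transfer J F f"
  proof
    obtain r where "r \<in> I" using nonempty by blast
    then obtain s where s: "s \<in> I" "r < s" using no_max by blast
    then have "s \<in> J" using \<open>r \<in> I\<close> nonneg by (auto simp: J_def)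
    then show "\<exists>r\<in>J. \<exists>s\<in>J. r < s" using right_neighbour by blast
  next
    fix r s :: real and u :: complex assume *: "r \<in> J" "s \<in> J" "r < s" "cmod u = 1"
    show "0 \<le> F s ^ 3 + 2 * (F r)\<^sup>2 * Re (f (of_real r * u)) - 3 * F s * (F r)\<^sup>2"
      if "0 < s ^ 3 + 2 * r ^ 3 * Re u - 3 * s * r\<^sup>2"
      using det_transfer[OF *] that by linarith
    show "F s ^ 3 + 2 * (F r)\<^sup>2 * Re (f (of_real r * u)) - 3 * F s * (F r)\<^sup>2 \<le> 0"
      if "s ^ 3 + 2 * r ^ 3 * Re u - 3 * s * r\<^sup>2 < 0"
      using det_transfer[OF *] that by linarith
  qed (use interval_J F_pos F_pos_mono(2) F_right f_of_real J_I f_norm f_mult in auto)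
  show "cmod (f 0) \<le> F y" if "0 \<in> I" "y \<in> J" for y
    using f_less[of y 0] that J_I by (simp add: less_imp_le)
qed

end

subsection \<open>The positive semidefinite case\<close>

locale psd_preserver = radial_domain +
  assumes preserves: "\<And>A. A \<in> mats_over n (annulus I) \<Longrightarrow> hermitian A \<Longrightarrow> pos_semidef A \<longleftrightarrow> pos_semidef (map_mat f A)"
    and no_min: "\<And>r. r \<in> I \<Longrightarrow> 0 < r \<Longrightarrow> \<exists>s\<in>I. s < r"
    and nonempty: "I \<inter> {0<..} \<noteq> {}"
begin

text \<open>The repeated diagonal entry is kept unchanged, so a single padding serves both
  directions and nothing about \<open>F\<close> has to be known beforehand.\<close>

lemma preserves_psd:
  assumes k: "1 \<le> k" "k \<le> 3" and B: "\<And>i j. i < k \<Longrightarrow> j < k \<Longrightarrow> cmod (B i j) \<in> I" and h: "herm k B"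
  shows "psd k B \<longleftrightarrow> psd k (\<lambda>i j. f (B i j))"
proof -
  let ?P = "pad k B (B (k - 1) (k - 1))"
  have kn: "k \<le> n" using k n3 by simp
  have "cnj (B (k - 1) (k - 1)) = B (k - 1) (k - 1)" using hermD[OF h, of "k - 1" "k - 1"] k by simp
  then have hP: "herm n ?P" by (intro herm_pad k kn h) (simp add: Reals_cnj_iff)
  have "cmod (?P i j) \<in> I" for i j by (intro pad_in_annulus k B) (use k in auto)
  then have "?P i j \<in> annulus I" for i j by (simp add: annulus_def)
  note m = mat_of_fun_in_mats_over[where \<Omega> = "annulus I", OF hP this]
  have "psd n ?P \<longleftrightarrow> psd n (\<lambda>i j. f (?P i j))" using preserves[OF m(1,2)] m(5) m(6)[of f] by simp
  then show ?thesis
    unfolding map_pad psd_pad_iff[OF k(1) kn]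
    using psd_pad_iff[OF k(1) kn, of "\<lambda>i j. f (B i j)"] by simp
qed

text \<open>The matrix with diagonal |w| and entry \<open>w\<close> has rank at most 1 and is
  semidefinite, so no radius beyond |w| is called for.\<close>

lemma f_cnj_nonneg:
  assumes w: "cmod w \<in> I"
  shows "f (cnj w) = cnj (f w)" "0 \<le> f (of_real (cmod w))"
proof -
  let ?r = "cmod w"
  let ?B = "mat2 (of_real ?r) (of_real ?r) w"
  have "psd 2 ?B"
  proof (cases "w = 0")
    case True
    then show ?thesis using psd_mat2_zero[of 0] by simp
  next
    case False
    then have "0 < ?r" by simp
    from psd_mat2_iff[OF this] show ?thesis by (simp add: power2_eq_square)
  qed
  then have *: "psd 2 (\<lambda>i j. f (?B i j))"
    using preserves_psd[of 2 ?B] mat2_in_annulus w herm_mat2 by simp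
  then have "herm 2 (\<lambda>i j. f (?B i j))" by (simp add: psd_def)
  from hermD[OF this, of 0 1] show c: "f (cnj w) = cnj (f w)" by (simp add: mat2_def)
  show "0 \<le> f (of_real ?r)" using * unfolding map_mat2[OF c] by (rule nonneg_of_psd_mat2)
qed

lemma f_of_real:
  assumes "r \<in> I"
  shows "f (of_real r) = of_real (F r)" "0 \<le> F r"
proof -
  have "0 \<le> r" using assms nonneg by auto
  then have "0 \<le> f (of_real r)" using f_cnj_nonneg(2)[of "of_real r"] assms by simp
  then show "f (of_real r) = of_real (F r)" "0 \<le> F r"
    by (auto simp: F_def complex_eq_iff less_eq_complex_def)
qed

text \<open>Strictness comes from a matrix that fails to be semidefinite: diagonal s, r and
  off-diagonal entry s give determinant s (r - s) < 0, and the failure passes to the image.\<close>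

lemma F_mono:
  assumes r: "r \<in> I" and s: "s \<in> I" and rs: "r < s"
  shows "F r < F s"
proof -
  let ?B = "mat2 (of_real s) (of_real r) (of_real s)"
  have s0: "0 < s" using r rs nonneg by auto
  have "\<not> psd 2 ?B" unfolding psd_mat2_iff[OF s0] using rs s0 by (simp add: power2_eq_square)
  then have "\<not> psd 2 (\<lambda>i j. f (?B i j))"
    using preserves_psd[of 2 ?B] mat2_in_annulus r s s0 herm_mat2 by simp
  then have *: "\<not> psd 2 (mat2 (of_real (F s)) (of_real (F r)) (of_real (F s)))"
    using map_mat2[of f "of_real s"] f_of_real r s by simp
  \<comment> \<open>Otherwise the image would be diagonal with entries 0 and F(r), hence
    semidefinite.\<close>
  have "F s \<noteq> 0"
  proof
    assume "F s = 0"
    then show False using * psd_mat2_zero[OF f_of_real(2)[OF r]] by simp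
  qed
  then have "0 < F s" using f_of_real(2)[OF s] by linarith
  then show ?thesis using * by (simp add: psd_mat2_iff power2_eq_square)
qed

lemma left_neighbour:
  assumes "s \<in> J"
  shows "\<exists>r\<in>J. r < s"
proof -
  obtain r where r: "r \<in> I" "r < s" using no_min assms J_I by blast
  \<comment> \<open>\<open>no_min\<close> may return 0, which is not in \<open>J\<close>; the
    midpoint is positive.\<close>
  then have "(r + s) / 2 \<in> I"
    using mem_is_interval_1_I[OF interval r(1), of s "(r + s) / 2"] assms J_I by auto
  moreover have "0 \<le> r" "0 < s" using r nonneg assms J_I by auto
  ultimately show ?thesis using r by (intro bexI[of _ "(r + s) / 2"]) (auto simp: J_def)
qed

lemma F_pos:
  assumes "s \<in> J"
  shows "0 < F s"
proof -
  obtain r where "r \<in> J" "r < s" using left_neighbour assms by blast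
  then show ?thesis using F_mono[of r s] f_of_real(2)[of r] assms J_I by fastforce
qed

lemma mat2_transfer:
  assumes "x \<in> J" "z \<in> J" "cmod w \<in> I"
  shows "(cmod w)\<^sup>2 \<le> x * z \<longleftrightarrow> (cmod (f w))\<^sup>2 \<le> F x * F z"
proof -
  let ?B = "mat2 (of_real x) (of_real z) w"
  have I: "x \<in> I" "z \<in> I" "0 < x" using assms J_I by auto
  have "psd 2 ?B \<longleftrightarrow> psd 2 (\<lambda>i j. f (?B i j))"
    using preserves_psd[of 2 ?B] mat2_in_annulus I assms herm_mat2 by simp
  also have "(\<lambda>i j. f (?B i j)) = mat2 (of_real (F x)) (of_real (F z)) (f w)"
    using map_mat2[OF f_cnj_nonneg(1)[OF assms(3)]] f_of_real I by simp
  finally show ?thesis unfolding psd_mat2_iff[OF I(3)] psd_mat2_iff[OF F_pos[OF assms(1)]] .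
qed

lemma mat2_transfer_real:
  assumes "x \<in> J" "y \<in> J" "z \<in> J"
  shows "y\<^sup>2 \<le> x * z \<longleftrightarrow> (F y)\<^sup>2 \<le> F x * F z"
  using mat2_transfer[OF assms(1,3), of "of_real y"] f_of_real[of y] J_I[of y] assms(2) by simp

text \<open>The upper bound is direct from a singular semidefinite matrix. For the lower one, if |f
  w| < F(|w|), some y < |w| still has |f w| < F(y); then the image of the matrix with diagonal y and
  entry \<open>w\<close> is semidefinite, which forces |w| <= y.\<close>

lemma f_norm:
  assumes w: "cmod w \<in> J"
  shows "cmod (f w) = F (cmod w)"
proof (rule antisym)
  let ?r = "cmod w"
  have r: "?r \<in> I" "0 < F ?r" using w J_I F_pos by auto
  have "(cmod (f w))\<^sup>2 \<le> (F ?r)\<^sup>2"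
    using mat2_transfer[OF w w r(1)] by (simp add: power2_eq_square)
  then show "cmod (f w) \<le> F ?r" using r(2) by (auto intro: power2_le_imp_le)
  show "F ?r \<le> cmod (f w)"
  proof (rule ccontr)
    assume "\<not> ?thesis"
    then have less: "cmod (f w) < F ?r" by simp
    obtain b where b: "b \<in> J" "b < ?r" using left_neighbour w by blast
    have "\<exists>y\<in>{b..<?r}. cmod (f w) < F y"
    proof (rule left_approx_of_log_midconcave[where F = F, OF interval_J F_pos _ w b less])
      fix x y z assume "x \<in> J" "y \<in> J" "z \<in> J" "x * z < y\<^sup>2"
      then show "F x * F z \<le> (F y)\<^sup>2" using mat2_transfer_real[of x y z] by linarith
    qed
    then obtain y where y: "b \<le> y" "y < ?r" "cmod (f w) < F y" by auto
    then have yJ: "y \<in> J" using mem_is_interval_1_I[OF interval_J(1) b(1) w, of y] by simp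
    then have "0 < y" using J_I by blast
    have "(cmod (f w))\<^sup>2 \<le> F y * F y" using y(3) by (simp add: power_mono flip: power2_eq_square)
    then have "?r\<^sup>2 \<le> y\<^sup>2" using mat2_transfer[OF yJ yJ r(1)] by (simp add: power2_eq_square)
    then have "?r \<le> y" using \<open>0 < y\<close> by (auto intro: power2_le_imp_le)
    then show False using y(2) by simp
  qed
qed

lemma f_less:
  assumes "s \<in> J" "cmod u \<in> J" "cmod u < s"
  shows "cmod (f u) < F s"
  using assms f_norm F_mono J_I by simp

lemma mat3_transfer:
  assumes "a \<in> J" "cmod u \<in> J" "cmod v \<in> J" "cmod w \<in> J" "cmod u < a"
  shows "0 \<le> det3 a u v w \<longleftrightarrow> 0 \<le> det3 (F a) (f u) (f v) (f w)"
proof -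
  let ?B = "mat3 (of_real a) u v w"
  have I: "a \<in> I" "0 < a" "cmod u \<in> I" "cmod v \<in> I" "cmod w \<in> I" using assms J_I by auto
  have "psd 3 ?B \<longleftrightarrow> psd 3 (\<lambda>i j. f (?B i j))"
    using preserves_psd[of 3 ?B] mat3_in_annulus I herm_mat3 by simp
  also have "(\<lambda>i j. f (?B i j)) = mat3 (of_real (F a)) (f u) (f v) (f w)"
    using map_mat3[of f u v w] f_cnj_nonneg(1) I f_of_real by simp
  finally show ?thesis
    unfolding psd_mat3_iff[OF I(2) assms(5)] psd_mat3_iff[OF F_pos[OF assms(1)] f_less[OF assms(1,2,5)]] .
qed

lemma F_right:
  assumes "r \<in> J" "s \<in> J" "r < s"
  shows "(F \<longlongrightarrow> F r) (at_right r)"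
proof (rule right_continuous_of_log_midconvex[where F = F, OF interval_J F_pos _ _ assms])
  fix x y z assume "x \<in> J" "y \<in> J" "z \<in> J" "y\<^sup>2 < x * z"
  then show "(F y)\<^sup>2 \<le> F x * F z" using mat2_transfer_real[of x y z] by linarith
qed (use F_mono J_I in auto)

text \<open>Semidefiniteness admits the singular matrix with diagonal \<open>s\<close> itself, so no
  limit is taken.\<close>

lemma f_mult:
  assumes r: "r \<in> J" and s: "s \<in> J" and rs: "r < s" and u: "cmod u = 1" and w: "cmod w = 1"
  shows "f (of_real r * u) * f (of_real r * w) * cnj (f (of_real s * (u * w))) = of_real ((F r)\<^sup>2 * F s)"
    (is "?X = _")
proof (rule complex_eq_of_real_if_Re_ge)
  have rs0: "0 < r" "0 < s" using r s J_I by auto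
  have n: "cmod (of_real r * u) = r" "cmod (of_real r * w) = r" "cmod (of_real s * (u * w)) = s"
    using u w rs0 by (auto simp: norm_mult)
  have fn: "cmod (f (of_real r * u)) = F r" "cmod (f (of_real r * w)) = F r" "cmod (f (of_real s * (u * w))) = F s"
    using f_norm n r s by metis+
  then show "cmod ?X = (F r)\<^sup>2 * F s" by (simp add: norm_mult power2_eq_square)
  have "0 \<le> det3 s (of_real r * u) (of_real s * (u * w)) (of_real r * w)"
    by (simp add: det3_product[OF u w])
  then have "0 \<le> det3 (F s) (f (of_real r * u)) (f (of_real s * (u * w))) (f (of_real r * w))"
    by (subst (asm) mat3_transfer) (use n r s rs in auto)
  then show "(F r)\<^sup>2 * F s \<le> Re ?X"
    unfolding det3_def fn by (simp add: algebra_simps power2_eq_square power3_eq_cube)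
qed

lemma det_transfer:
  assumes r: "r \<in> J" and s: "s \<in> J" and rs: "r < s" and u: "cmod u = 1"
  shows "0 \<le> s ^ 3 + 2 * r ^ 3 * Re u - 3 * s * r\<^sup>2 \<longleftrightarrow>
    0 \<le> F s ^ 3 + 2 * (F r)\<^sup>2 * Re (f (of_real r * u)) - 3 * F s * (F r)\<^sup>2"
proof -
  have r0: "0 < r" "r \<in> I" using r J_I by auto
  have n: "cmod (of_real r * u) = r" using u r0 by (simp add: norm_mult)
  have fn: "cmod (f (of_real r * u)) = F r" using f_norm n r by metis
  have "0 \<le> det3 s (of_real r * u) (of_real r) (of_real r) \<longleftrightarrow>
    0 \<le> det3 (F s) (f (of_real r * u)) (f (of_real r)) (f (of_real r))"
    by (rule mat3_transfer) (use s n r r0 rs in auto)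
  then show ?thesis
    unfolding det3_phase[OF u] f_of_real(1)[OF r0(2)] unfolding det3_def fn
    by (simp add: algebra_simps power2_eq_square)
qed

lemma linear:
  "\<exists>\<alpha>>0. (\<forall>z\<in>annulus I. f z = of_real \<alpha> * z) \<or> (\<forall>z\<in>annulus I. f z = of_real \<alpha> * cnj z)"
proof (rule linear_on_annulus)
  show "radial_transfer J F f"
  proof
    obtain s where "s \<in> J" using nonempty by (auto simp: J_def)
    then show "\<exists>r\<in>J. \<exists>s\<in>J. r < s" using left_neighbour by blast
  next
    fix r s :: real and u :: complex assume *: "r \<in> J" "s \<in> J" "r < s" "cmod u = 1"
    show "0 \<le> F s ^ 3 + 2 * (F r)\<^sup>2 * Re (f (of_real r * u)) - 3 * F s * (F r)\<^sup>2"
      if "0 < s ^ 3 + 2 * r ^ 3 * Re u - 3 * s * r\<^sup>2"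
      using det_transfer[OF *] that by linarith
    show "F s ^ 3 + 2 * (F r)\<^sup>2 * Re (f (of_real r * u)) - 3 * F s * (F r)\<^sup>2 \<le> 0"
      if "s ^ 3 + 2 * r ^ 3 * Re u - 3 * s * r\<^sup>2 < 0"
      using det_transfer[OF *] that by linarith
  qed (use interval_J F_pos F_mono F_right f_of_real J_I f_norm f_mult in auto)
  show "cmod (f 0) \<le> F y" if "0 \<in> I" "y \<in> J" for y
    using f_of_real[OF that(1)] F_mono[OF that(1), of y] that(2) J_I by simp
qed

end

subsection \<open>The theorem\<close>

lemma radii_annulus:
  assumes "I \<subseteq> {0..}"
  shows "radii (annulus I) = I"
  using assms by (auto simp: radii_def annulus_def)

lemma neg_in_annulus_minus_radii:
  assumes "I \<subseteq> {0..}" "r \<in> I" "0 < r"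
  shows "- complex_of_real r \<in> annulus I - complex_of_real ` radii (annulus I)"
proof -
  have "- r \<notin> I" using assms(1,3) by auto
  then show ?thesis
    unfolding radii_annulus[OF assms(1)] using assms(2,3)
    by (auto simp: annulus_def simp flip: of_real_minus)
qed

theorem theorem3:
  fixes n :: nat and \<Omega> :: "complex set" and f :: "complex \<Rightarrow> complex"
  assumes "n \<ge> 3" and "is_annulus \<Omega>" and "\<Omega> \<noteq> {0}"
  shows
    "(pd_type \<Omega> \<longrightarrow>
       ((\<forall>A \<in> mats_over n \<Omega>. hermitian A \<longrightarrow> (pos_def A \<longleftrightarrow> pos_def (map_mat f A))) \<longleftrightarrow>
        (\<exists>\<alpha>::real. \<alpha> > 0 \<and>
           ((\<forall>z\<in>\<Omega>. f z = complex_of_real \<alpha> * z) \<or>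
            (\<forall>z\<in>\<Omega>. f z = complex_of_real \<alpha> * cnj z)))))
     \<and>
     (psd_type \<Omega> \<longrightarrow>
       ((\<forall>A \<in> mats_over n \<Omega>. hermitian A \<longrightarrow> (pos_semidef A \<longleftrightarrow> pos_semidef (map_mat f A))) \<longleftrightarrow>
        (\<exists>\<alpha>::real. \<alpha> > 0 \<and>
           ((\<forall>z\<in>\<Omega>. f z = complex_of_real \<alpha> * z) \<or>
            (\<forall>z\<in>\<Omega>. f z = complex_of_real \<alpha> * cnj z)))))"
proof (cases "\<Omega> = {}")
  case True
  \<comment> \<open>Since n is positive, there are no matrices over the empty set, and both
    conditions are vacuous.\<close>
  have "mats_over n \<Omega> = {}"
  proof (rule equals0I)
    fix A assume "A \<in> mats_over n \<Omega>"
    then have "A $$ (0, 0) \<in> \<Omega>"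
      using elements_matI[of A n n 0 0] assms(1) by (auto simp: mats_over_def)
    then show False using True by simp
  qed
  then show ?thesis using True by (auto intro: exI[of _ 1])
next
  case False
  obtain I where I: "is_interval I" "I \<subseteq> {0..}" "\<Omega> = annulus I"
    using assms(2) by (auto simp: is_annulus_def)
  \<comment> \<open>For \<Omega> = {0} the claim would fail: the only matrix is 0, neither it nor
    its image (of rank at most 1) is definite, and f 0 could be any number.\<close>
  obtain z where "z \<in> \<Omega>" "z \<noteq> 0" using False assms(3) by blast
  then have c: "cmod z \<in> I" "0 < cmod z" by (auto simp: I annulus_def)
  \<comment> \<open>The point -r has modulus r without being a nonnegative real, so the type
    condition yields a radius on the required side of r.\<close>
  have neg: "- complex_of_real r \<in> \<Omega> - complex_of_real ` radii \<Omega>" if "r \<in> I" "0 < r" for r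
    unfolding I(3) by (rule neg_in_annulus_minus_radii[OF I(2) that])
  have radii: "radii \<Omega> = I" unfolding I(3) by (rule radii_annulus[OF I(2)])
  show ?thesis
  proof (intro conjI impI iffI)
    assume type: "pd_type \<Omega>"
      and pres: "\<forall>A \<in> mats_over n \<Omega>. hermitian A \<longrightarrow> (pos_def A \<longleftrightarrow> pos_def (map_mat f A))"
    interpret pd_preserver n I f
    proof
      fix r assume r: "r \<in> I"
      show "\<exists>s\<in>I. r < s"
      proof (cases "0 < r")
        case True
        obtain e where "0 < e" "cmod (- complex_of_real r) + e \<in> radii \<Omega>"
          using type neg[OF r True] unfolding pd_type_def by blast
        then show ?thesis using True radii by (intro bexI[of _ "r + e"]) auto
      next
        case False
        \<comment> \<open>Here r = 0, and the nonzero point chosen above has larger modulus.\<close>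
        then show ?thesis using c r I(2) by force
      qed
    qed (use assms(1) I pres c in auto)
    show "\<exists>\<alpha>::real. \<alpha> > 0 \<and> ((\<forall>z\<in>\<Omega>. f z = complex_of_real \<alpha> * z) \<or> (\<forall>z\<in>\<Omega>. f z = complex_of_real \<alpha> * cnj z))"
      using linear unfolding I(3) .
  next
    assume type: "psd_type \<Omega>"
      and pres: "\<forall>A \<in> mats_over n \<Omega>. hermitian A \<longrightarrow> (pos_semidef A \<longleftrightarrow> pos_semidef (map_mat f A))"
    interpret psd_preserver n I f
    proof
      fix r :: real assume r: "r \<in> I" "0 < r"
      obtain d where "0 < d" "cmod (- complex_of_real r) - d \<in> radii \<Omega>"
        using type neg[OF r] unfolding psd_type_def by blast
      then show "\<exists>s\<in>I. s < r" using r radii by (intro bexI[of _ "r - d"]) auto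
    qed (use assms(1) I pres c in auto)
    show "\<exists>\<alpha>::real. \<alpha> > 0 \<and> ((\<forall>z\<in>\<Omega>. f z = complex_of_real \<alpha> * z) \<or> (\<forall>z\<in>\<Omega>. f z = complex_of_real \<alpha> * cnj z))"
      using linear unfolding I(3) .
  qed (use linear_or_conjugate_preserves in blast)+
qed

end
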